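(* Let $G_1$ and $G_2$ be two connected regular cospectral graphs and let $H$ be any connected regular graph. Then: 1. $G_1\,\dot\vee\,H$ and $G_2\,\dot\vee\,H$ are $\epsilon$-cospectral; 2. $H\,\dot\vee\,G_1$ and $H\,\dot\vee\,G_2$ are $\epsilon$-cospectral.
   Context: All graphs are finite, simple and undirected. The subdivision graph $S(G)$ of a graph $G$ is obtained from $G$ by subdividing each edge with one new vertex; $I(G)$ is the set of these new vertices, so $V(S(G))=V(G)\cup I(G)$. For vertex-disjoint graphs $G_1,G_2$, the subdivision-vertex join $G_1\,\dot\vee\,G_2$ is obtained from $S(G_1)$ and $G_2$ by joining each vertex of $V(G_1)$ to every vertex of $V(G_2)$. For a connected graph $G$ with distance function $d$, the eccentricity of a vertex $v$ is $e(v)=\max\{d(v,u):u\in V(G)\}$. The eccentricity matrix $\epsilon(G)$ is the symmetric matrix indexed by $V(G)$ with $(u,v)$ entry $d(u,v)$ if $d(u,v)=\min\{e(u),e(v)\}$, and $0$ otherwise. The $\epsilon$-spectrum of $G$ is the multiset of eigenvalues of $\epsilon(G)$. Two graphs are cospectral if they are non-isomorphic, have the same order, and their adjacency matrices have the same spectrum (with multiplicities). Two connected graphs are $\epsilon$-cospectral if they are non-isomorphic, have the same order, and have the same $\epsilon$-spectrum. *)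

theory Defs
  imports
    "HOL-Computational_Algebra.Fundamental_Theorem_Algebra"
    "Jordan_Normal_Form.Char_Poly"
    "Graph_Theory.Graph_Theory"
begin

text \<open>
  A finite simple undirected graph is a \<open>pair_graph\<close>: finitely many vertices, and a finite
  irreflexive symmetric arc relation, each undirected edge being represented by its two arcs.
\<close>

definition connected_graph :: "'a pair_pre_digraph \<Rightarrow> bool" where
  "connected_graph G \<longleftrightarrow> pair_graph G \<and> Digraph_Component.connected G"

text \<open>In a symmetric loop-free digraph the out-degree is the degree of the undirected graph.\<close>

definition regular_graph :: "'a pair_pre_digraph \<Rightarrow> bool" where
  "regular_graph G \<longleftrightarrow> (\<exists>r. \<forall>v \<in> pverts G. out_degree G v = r)"


subsection \<open>Subdivision graph and subdivision-vertex join\<close>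

definition edge_set :: "'a pair_pre_digraph \<Rightarrow> 'a set set" where
  "edge_set G = {{u, v} | u v. (u, v) \<in> parcs G}"

text \<open>
  \<open>Inl v\<close> is the original vertex \<open>v\<close> and \<open>Inr e\<close> is the new vertex subdividing the edge \<open>e\<close>.
\<close>

definition subdivision_graph :: "'a pair_pre_digraph \<Rightarrow> ('a + 'a set) pair_pre_digraph" where
  "subdivision_graph G =
    \<lparr> pverts = pverts G <+> edge_set G,
      parcs = {(Inl v, Inr e) | v e. e \<in> edge_set G \<and> v \<in> e}
            \<union> {(Inr e, Inl v) | v e. e \<in> edge_set G \<and> v \<in> e} \<rparr>"

text \<open>
  The outer sum type makes the vertex sets of the two operands disjoint, so the operation is
  total and no disjointness hypothesis is needed.
\<close>

definition subdivision_vertex_join ::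
    "'a pair_pre_digraph \<Rightarrow> 'b pair_pre_digraph \<Rightarrow> (('a + 'a set) + 'b) pair_pre_digraph" where
  "subdivision_vertex_join G1 G2 =
    \<lparr> pverts = pverts (subdivision_graph G1) <+> pverts G2,
      parcs = {(Inl x, Inl y) | x y. (x, y) \<in> parcs (subdivision_graph G1)}
            \<union> {(Inr x, Inr y) | x y. (x, y) \<in> parcs G2}
            \<union> {(Inl (Inl u), Inr w) | u w. u \<in> pverts G1 \<and> w \<in> pverts G2}
            \<union> {(Inr w, Inl (Inl u)) | u w. u \<in> pverts G1 \<and> w \<in> pverts G2} \<rparr>"


subsection \<open>Adjacency matrix, eccentricity matrix and their spectra\<close>

text \<open>
  The library's shortest-path cost for unit arc costs, i.e. the least number of arcs of a walk;
  it is finite on connected graphs, the only ones to which it is applied.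
\<close>

definition graph_dist :: "'a pair_pre_digraph \<Rightarrow> 'a \<Rightarrow> 'a \<Rightarrow> real" where
  "graph_dist G u v = real_of_ereal (wf_digraph.\<mu> G (\<lambda>_. 1) u v)"

definition eccentricity :: "'a pair_pre_digraph \<Rightarrow> 'a \<Rightarrow> real" where
  "eccentricity G v = Max {graph_dist G v u | u. u \<in> pverts G}"

text \<open>
  Matrices of the library are indexed by initial segments of the naturals, so a matrix indexed by
  vertices is read off along an arbitrarily chosen enumeration of the vertex set. Another choice
  conjugates the matrix by a permutation matrix and leaves the spectrum unchanged.
\<close>

definition vertex_list :: "'a pair_pre_digraph \<Rightarrow> 'a list" where
  "vertex_list G = (SOME vs. distinct vs \<and> set vs = pverts G)"

definition vertex_matrix :: "'a pair_pre_digraph \<Rightarrow> ('a \<Rightarrow> 'a \<Rightarrow> real) \<Rightarrow> real mat" where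
  "vertex_matrix G f =
    mat (card (pverts G)) (card (pverts G)) (\<lambda>(i, j). f (vertex_list G ! i) (vertex_list G ! j))"

definition adjacency_matrix :: "'a pair_pre_digraph \<Rightarrow> real mat" where
  "adjacency_matrix G = vertex_matrix G (\<lambda>u v. if (u, v) \<in> parcs G then 1 else 0)"

definition eccentricity_matrix :: "'a pair_pre_digraph \<Rightarrow> real mat" where
  "eccentricity_matrix G = vertex_matrix G (\<lambda>u v.
    if graph_dist G u v = min (eccentricity G u) (eccentricity G v) then graph_dist G u v else 0)"

text \<open>
  Eigenvalues with algebraic multiplicity. They are taken over the complex numbers, so that the
  multiset always has as many elements as the matrix has rows; for the symmetric matrices above
  all of them are real.
\<close>

definition eigenvalue_mset :: "real mat \<Rightarrow> complex multiset" where
  "eigenvalue_mset A = proots (char_poly (map_mat complex_of_real A))"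


subsection \<open>Cospectrality\<close>

definition cospectral :: "'a pair_pre_digraph \<Rightarrow> 'b pair_pre_digraph \<Rightarrow> bool" where
  "cospectral G1 G2 \<longleftrightarrow>
     \<not> digraph_iso G1 G2 \<and>
     card (pverts G1) = card (pverts G2) \<and>
     eigenvalue_mset (adjacency_matrix G1) = eigenvalue_mset (adjacency_matrix G2)"

definition eps_cospectral :: "'a pair_pre_digraph \<Rightarrow> 'b pair_pre_digraph \<Rightarrow> bool" where
  "eps_cospectral G1 G2 \<longleftrightarrow>
     connected_graph G1 \<and> connected_graph G2 \<and>
     \<not> digraph_iso G1 G2 \<and>
     card (pverts G1) = card (pverts G2) \<and>
     eigenvalue_mset (eccentricity_matrix G1) = eigenvalue_mset (eccentricity_matrix G2)"

end

theory Submission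
  imports Defs
begin

text \<open>
  Order the vertices of the join as \<open>V(G)\<close>, \<open>I(G)\<close>, \<open>V(H)\<close>. For regular \<open>G\<close> and \<open>H\<close> all distances are
  at most 4 and the eccentricity is constant on each of the three classes, with a value that depends
  only on the orders and degrees. Hence the eccentricity matrix is \<open>M + T C T\<^sup>t\<close>, where \<open>T\<close> is the
  indicator matrix of the classes, \<open>C\<close> is 3 by 3, and \<open>M\<close> is block diagonal: with \<open>B\<close> the
  vertex-edge incidence matrix of \<open>G\<close>, its blocks are
  \<open>[[a I, b B], [b B\<^sup>t, c I + d B\<^sup>t B]]\<close> and \<open>p I + q A(H)\<close>. By regularity \<open>M T = T Q\<close> for a 3 by 3
  matrix \<open>Q\<close>, so Sylvester's identity gives
  \<open>det (t - M - T C T\<^sup>t) = det (t - M) det (1 - (t - Q)\<^sup>-\<^sup>1 C T\<^sup>t T)\<close>, and a Schur complement together with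
  \<open>B B\<^sup>t = r I + A(G)\<close> expresses \<open>det (t - M)\<close> through the characteristic polynomials of \<open>A(G)\<close> and
  \<open>A(H)\<close>. Cospectral regular graphs have the same degree, because the degree is the largest eigenvalue.

  For non-isomorphism, a connected regular graph is complete or has degree at least 2. So
  non-isomorphic \<open>G\<^sub>1\<close> and \<open>G\<^sub>2\<close> have degree at least 2, and then the vertices of \<open>I\<close> are exactly the
  vertices of degree 2 of the join, which allows either factor to be recovered from the join.
\<close>

section \<open>Matrices indexed by lists\<close>

definition kmat :: "'a list \<Rightarrow> 'b list \<Rightarrow> ('a \<Rightarrow> 'b \<Rightarrow> 'c) \<Rightarrow> 'c mat" where
  "kmat xs ys f = mat (length xs) (length ys) (\<lambda>(i, j). f (xs ! i) (ys ! j))"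

lemma kmat_carrier [simp, intro]: "kmat xs ys f \<in> carrier_mat (length xs) (length ys)"
  by (simp add: kmat_def)

lemma kmat_dim [simp]: "dim_row (kmat xs ys f) = length xs" "dim_col (kmat xs ys f) = length ys"
  by (simp_all add: kmat_def)

lemma kmat_index [simp]:
  "i < length xs \<Longrightarrow> j < length ys \<Longrightarrow> kmat xs ys f $$ (i, j) = f (xs ! i) (ys ! j)"
  by (simp add: kmat_def)

lemma kmat_cong:
  assumes "\<And>x y. x \<in> set xs \<Longrightarrow> y \<in> set ys \<Longrightarrow> f x y = g x y"
  shows "kmat xs ys f = kmat xs ys g"
  using assms by (intro eq_matI) auto

lemma kmat_mult:
  fixes f :: "'a \<Rightarrow> 'b \<Rightarrow> 'd::comm_semiring_0"
  assumes "distinct ys"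
  shows "kmat xs ys f * kmat ys zs g = kmat xs zs (\<lambda>x z. \<Sum>y\<in>set ys. f x y * g y z)"
proof (rule eq_matI, goal_cases)
  case (1 i j)
  have "(\<Sum>y\<in>set ys. f (xs ! i) y * g y (zs ! j)) = (\<Sum>k<length ys. f (xs ! i) (ys ! k) * g (ys ! k) (zs ! j))"
    by (rule sum.reindex_bij_betw[symmetric], rule bij_betw_nth[OF assms]) auto
  with 1 show ?case by (simp add: scalar_prod_def atLeast0LessThan)
qed auto

lemma kmat_add: "kmat xs ys f + kmat xs ys g = kmat xs ys (\<lambda>x y. f x y + g x y)"
  by (intro eq_matI) auto

lemma kmat_smult: "c \<cdot>\<^sub>m kmat xs ys f = kmat xs ys (\<lambda>x y. c * f x y)"
  by (intro eq_matI) auto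

lemma kmat_one: "distinct xs \<Longrightarrow> kmat xs xs (\<lambda>x y. if x = y then 1 else 0) = 1\<^sub>m (length xs)"
  by (intro eq_matI) (auto simp: nth_eq_iff_index_eq)

lemma kmat_zero: "kmat xs ys (\<lambda>x y. 0) = 0\<^sub>m (length xs) (length ys)"
  by (intro eq_matI) auto

lemma kmat_map: "kmat (map g xs) (map h ys) f = kmat xs ys (\<lambda>x y. f (g x) (h y))"
  by (intro eq_matI) auto

lemma kmat_append:
  "kmat (xs @ ys) (us @ vs) f =
     four_block_mat (kmat xs us f) (kmat xs vs f) (kmat ys us f) (kmat ys vs f)"
  by (intro eq_matI) (auto simp: nth_append)

lemma char_poly_kmat_set_eq:
  fixes f :: "'a \<Rightarrow> 'a \<Rightarrow> 'b::comm_ring_1"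
  assumes "distinct xs" "distinct ys" "set xs = set ys"
  shows "char_poly (kmat xs xs f) = char_poly (kmat ys ys f)"
proof (rule char_poly_similar, rule similar_matI)
  let ?e = "\<lambda>x y. if x = y then 1 else 0 :: 'b"
  let ?P = "kmat xs ys ?e" and ?Q = "kmat ys xs ?e"
  have len: "length ys = length xs" using assms by (metis distinct_card)
  show "{kmat xs xs f, kmat ys ys f, ?P, ?Q} \<subseteq> carrier_mat (length xs) (length xs)"
    using len by (auto simp: kmat_def)
  have eq: "(\<Sum>y\<in>set xs. ?e x y * ?e y z) = ?e x z" if "x \<in> set xs" for x z
    using that by (simp add: if_distrib[of "\<lambda>a. a * _"] sum.delta' cong: if_cong)
  show "?P * ?Q = 1\<^sub>m (length xs)"
    unfolding kmat_mult[OF assms(2)] kmat_one[OF assms(1), symmetric] assms(3)[symmetric]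
    by (intro kmat_cong eq)
  show "?Q * ?P = 1\<^sub>m (length xs)"
    unfolding kmat_mult[OF assms(1)] len[symmetric] kmat_one[OF assms(2), symmetric]
    by (intro kmat_cong eq) (simp add: assms)
  show "kmat xs xs f = ?P * kmat ys ys f * ?Q"
    unfolding kmat_mult[OF assms(2)] assms(3)[symmetric]
    by (intro kmat_cong)
      (simp add: if_distrib[of "\<lambda>a. a * _"] if_distrib[of "\<lambda>a. _ * a"] sum.delta sum.delta' cong: if_cong)
qed

lemma poly_char_poly_kmat:
  fixes f :: "'a \<Rightarrow> 'a \<Rightarrow> 'b::field"
  assumes "distinct xs"
  shows "poly (char_poly (kmat xs xs f)) t = det (kmat xs xs (\<lambda>x y. (if x = y then t else 0) - f x y))"
  unfolding char_poly_def
  by (rule poly_det_cong[of _ "length xs"])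
    (auto simp: char_poly_matrix_def nth_eq_iff_index_eq[OF assms])

lemma det_one_add_mult_comm:
  fixes T :: "'a::idom mat"
  assumes T: "T \<in> carrier_mat n k" and X: "X \<in> carrier_mat k n"
  shows "det (1\<^sub>m n + T * X) = det (1\<^sub>m k + X * T)"
proof -
  let ?L = "four_block_mat (1\<^sub>m n) (-T) X (1\<^sub>m k)"
  have car: "four_block_mat (1\<^sub>m n) (0\<^sub>m n k) X (1\<^sub>m k) \<in> carrier_mat (n+k) (n+k)"
    "four_block_mat (1\<^sub>m n) (-T) (0\<^sub>m k n) (1\<^sub>m k + X * T) \<in> carrier_mat (n+k) (n+k)"
    "four_block_mat (1\<^sub>m n + T * X) (-T) (0\<^sub>m k n) (1\<^sub>m k) \<in> carrier_mat (n+k) (n+k)"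
    using T X by auto
  have a: "four_block_mat (1\<^sub>m n) (0\<^sub>m n k) X (1\<^sub>m k) *
      four_block_mat (1\<^sub>m n) (-T) (0\<^sub>m k n) (1\<^sub>m k + X * T) = ?L"
    apply (subst mult_four_block_mat[of _ n n _ k _ k _ _ n _ k])
    using T X by (auto intro!: cong_four_block_mat eq_matI simp: scalar_prod_def sum_negf)
  have b: "four_block_mat (1\<^sub>m n + T * X) (-T) (0\<^sub>m k n) (1\<^sub>m k) *
      four_block_mat (1\<^sub>m n) (0\<^sub>m n k) X (1\<^sub>m k) = ?L"
    apply (subst mult_four_block_mat[of _ n n _ k _ k _ _ n _ k])
    using T X by (auto intro!: cong_four_block_mat eq_matI simp: scalar_prod_def sum_negf)
  have d1: "det (four_block_mat (1\<^sub>m n) (0\<^sub>m n k) X (1\<^sub>m k)) = 1"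
    using X by (subst det_four_block_mat_upper_right_zero[of _ n _ k]) auto
  have "det ?L = det (1\<^sub>m k + X * T)"
    unfolding a[symmetric] det_mult[OF car(1,2)] d1
    using T X by (subst det_four_block_mat_lower_left_zero[of _ n _ k]) auto
  moreover have "det ?L = det (1\<^sub>m n + T * X)"
    unfolding b[symmetric] det_mult[OF car(3,1)] d1
    using T X by (subst det_four_block_mat_lower_left_zero[of _ n _ k]) auto
  ultimately show ?thesis by simp
qed

lemma det_add_mult_right_invariant:
  fixes K :: "'a::idom mat"
  assumes K: "K \<in> carrier_mat n n" and T: "T \<in> carrier_mat n k" and S: "S \<in> carrier_mat k n"
    and Q: "Q \<in> carrier_mat k k" and R: "R \<in> carrier_mat k k" and C: "C \<in> carrier_mat k k"
    and KT: "K * T = T * Q" and QR: "Q * R = 1\<^sub>m k"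
  shows "det (K + T * C * S) = det K * det (1\<^sub>m k + R * C * (S * T))"
proof -
  have "K * (T * (R * C * S)) = (K * T) * (R * C * S)"
    using K T R C S by (simp add: assoc_mult_mat[of _ n n _ k _ n])
  also have "\<dots> = T * (Q * (R * C * S))"
    unfolding KT using T Q R C S by (simp add: assoc_mult_mat[of _ n k _ k _ n])
  also have "Q * (R * C * S) = (Q * R) * (C * S)"
    using Q R C S by (simp add: assoc_mult_mat[of _ k k _ k _ n])
  also have "T * (Q * R * (C * S)) = T * C * S"
    unfolding QR using T C S by (simp add: assoc_mult_mat[of _ n k _ k _ n])
  finally have "K + T * C * S = K * (1\<^sub>m n + T * (R * C * S))"
    using K T R C S by (subst mult_add_distrib_mat[of _ n n _ n]) auto
  also have "det \<dots> = det K * det (1\<^sub>m n + T * (R * C * S))"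
    using K T R C S by (intro det_mult) auto
  also have "det (1\<^sub>m n + T * (R * C * S)) = det (1\<^sub>m k + R * C * S * T)"
    using T R C S by (intro det_one_add_mult_comm) auto
  also have "R * C * S * T = R * C * (S * T)"
    using T R C S by (intro assoc_mult_mat) auto
  finally show ?thesis .
qed

lemma poly_eqI_cofinite:
  fixes p q :: "'a::{idom,ring_char_0} poly"
  assumes "finite {t. poly p t \<noteq> poly q t}"
  shows "p = q"
proof (rule ccontr)
  assume "p \<noteq> q"
  then have "finite {t. poly (p - q) t = 0}" by (intro poly_roots_finite) simp
  then have "finite {t. poly p t = poly q t}" by (simp only: poly_diff right_minus_eq)
  with assms have "finite ({t. poly p t = poly q t} \<union> {t. poly p t \<noteq> poly q t})" by blast
  moreover have "{t. poly p t = poly q t} \<union> {t. poly p t \<noteq> poly q t} = (UNIV :: 'a set)" by auto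
  ultimately show False using infinite_UNIV_char_0[where 'a='a] by simp
qed

lemma char_poly_nonzero: "A \<in> carrier_mat n n \<Longrightarrow> char_poly A \<noteq> 0"
  using degree_monic_char_poly[of A n] by auto

lemma char_poly_add_class_function:
  fixes f :: "'a \<Rightarrow> 'a \<Rightarrow> 'c::field_char_0" and f' :: "'b \<Rightarrow> 'b \<Rightarrow> 'c"
    and cl :: "'a \<Rightarrow> 'k" and cl' :: "'b \<Rightarrow> 'k"
  assumes xs: "distinct xs" and xs': "distinct xs'"
    and cs: "distinct cs" "cl ` set xs \<subseteq> set cs" "cl' ` set xs' \<subseteq> set cs"
    and row: "\<And>x c. x \<in> set xs \<Longrightarrow> c \<in> set cs \<Longrightarrow> (\<Sum>y | y \<in> set xs \<and> cl y = c. f x y) = q (cl x) c"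
    and row': "\<And>x c. x \<in> set xs' \<Longrightarrow> c \<in> set cs \<Longrightarrow> (\<Sum>y | y \<in> set xs' \<and> cl' y = c. f' x y) = q (cl' x) c"
    and card: "\<And>c. c \<in> set cs \<Longrightarrow> card {x \<in> set xs. cl x = c} = card {x \<in> set xs'. cl' x = c}"
    and eq: "char_poly (kmat xs xs f) = char_poly (kmat xs' xs' f')"
  shows "char_poly (kmat xs xs (\<lambda>x y. f x y + g (cl x) (cl y))) =
         char_poly (kmat xs' xs' (\<lambda>x y. f' x y + g (cl' x) (cl' y)))"
proof (rule poly_eqI_cofinite, rule finite_subset)
  let ?q = "char_poly (kmat cs cs q)"
  show "finite {t. poly ?q t = 0}"
    using char_poly_nonzero[OF kmat_carrier] by (rule poly_roots_finite)
  let ?k = "length cs"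
  have *: "poly (char_poly (kmat xs xs (\<lambda>x y. f x y + g (cl x) (cl y)))) t =
      poly (char_poly (kmat xs xs f)) t *
      det (1\<^sub>m ?k + R * kmat cs cs (\<lambda>c d. - g c d) *
        kmat cs cs (\<lambda>c d. if c = d then of_nat (card {x \<in> set xs. cl x = c}) else 0))"
    if xs: "distinct xs" and cs2: "cl ` set xs \<subseteq> set cs"
    and row: "\<And>x c. x \<in> set xs \<Longrightarrow> c \<in> set cs \<Longrightarrow> (\<Sum>y | y \<in> set xs \<and> cl y = c. f x y) = q (cl x) c"
    and R: "R \<in> carrier_mat ?k ?k" "kmat cs cs (\<lambda>x y. (if x = y then t else 0) - q x y) * R = 1\<^sub>m ?k"
    for t R and xs :: "'z list" and f :: "'z \<Rightarrow> 'z \<Rightarrow> 'c" and cl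
  proof -
    let ?e = "\<lambda>x c. if cl x = c then 1 else 0 :: 'c"
    have cl: "cl x \<in> set cs" if "x \<in> set xs" for x using that cs2 by auto
    let ?K = "kmat xs xs (\<lambda>x y. (if x = y then t else 0) - f x y)"
    let ?T = "kmat xs cs ?e" and ?S = "kmat cs xs (\<lambda>c x. ?e x c)"
    have sd: "(\<Sum>d\<in>set cs. h d * ?e y d) = h (cl y)" if "y \<in> set xs" for y h
      using that cl by (simp add: if_distrib[of "\<lambda>a. _ * a"] sum.delta sum.delta' cong: if_cong)
    have sd': "(\<Sum>d\<in>set cs. ?e y d * h d) = h (cl y)" if "y \<in> set xs" for y h
      using sd[OF that] by (simp add: mult.commute)
    have TCS: "?T * kmat cs cs (\<lambda>c d. - g c d) * ?S = kmat xs xs (\<lambda>x y. - g (cl x) (cl y))"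
      unfolding kmat_mult[OF cs(1)] by (intro kmat_cong) (simp only: sd sd')
    have ST: "?S * ?T = kmat cs cs (\<lambda>c d. if c = d then of_nat (card {x \<in> set xs. cl x = c}) else 0)"
      unfolding kmat_mult[OF xs]
    proof (intro kmat_cong, goal_cases)
      case (1 c d)
      have "(\<Sum>y\<in>set xs. ?e y c * ?e y d) = (\<Sum>y\<in>set xs. if c = d \<and> cl y = c then 1 else 0)"
        by (intro sum.cong) auto
      also have "\<dots> = (if c = d then of_nat (card {x \<in> set xs. cl x = c}) else 0)"
        by (auto simp: sum.If_cases Int_def)
      finally show ?case .
    qed
    have KT: "?K * ?T = ?T * kmat cs cs (\<lambda>x y. (if x = y then t else 0) - q x y)"
      unfolding kmat_mult[OF cs(1)] kmat_mult[OF xs]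
    proof (intro kmat_cong, goal_cases)
      case (1 x c)
      have "(\<Sum>y\<in>set xs. ((if x = y then t else 0) - f x y) * ?e y c) =
          (\<Sum>y\<in>set xs. (if x = y then t * ?e x c else 0)) - (\<Sum>y\<in>set xs. if cl y = c then f x y else 0)"
        unfolding sum_subtractf[symmetric] by (intro sum.cong) auto
      also have "\<dots> = t * ?e x c - q (cl x) c"
        using 1 row[of x c] by (simp add: sum.If_cases Int_def)
      also have "\<dots> = (\<Sum>y\<in>set cs. ?e x y * ((if y = c then t else 0) - q y c))"
        using 1 by (simp add: sd')
      finally show ?case .
    qed
    have "poly (char_poly (kmat xs xs (\<lambda>x y. f x y + g (cl x) (cl y)))) t =
        det (?K + ?T * kmat cs cs (\<lambda>c d. - g c d) * ?S)"
      unfolding poly_char_poly_kmat[OF xs] TCS kmat_add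
      by (intro arg_cong[of _ _ det] kmat_cong) simp
    also have "\<dots> = det ?K * det (1\<^sub>m ?k + R * kmat cs cs (\<lambda>c d. - g c d) * (?S * ?T))"
      by (rule det_add_mult_right_invariant[OF _ _ _ _ R(1) _ KT R(2)]) auto
    finally show ?thesis unfolding ST poly_char_poly_kmat[OF xs] .
  qed
  show "{t. poly (char_poly (kmat xs xs (\<lambda>x y. f x y + g (cl x) (cl y)))) t \<noteq>
      poly (char_poly (kmat xs' xs' (\<lambda>x y. f' x y + g (cl' x) (cl' y)))) t} \<subseteq> {t. poly ?q t = 0}"
  proof (intro subsetI CollectI, elim CollectE, rule ccontr)
    fix t assume ne: "poly (char_poly (kmat xs xs (\<lambda>x y. f x y + g (cl x) (cl y)))) t \<noteq>
      poly (char_poly (kmat xs' xs' (\<lambda>x y. f' x y + g (cl' x) (cl' y)))) t"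
      and "poly ?q t \<noteq> 0"
    then have "det (kmat cs cs (\<lambda>x y. (if x = y then t else 0) - q x y)) \<noteq> 0"
      by (simp add: poly_char_poly_kmat[OF cs(1)])
    from det_non_zero_imp_unit[OF kmat_carrier this, of "()"]
    obtain R where R: "R \<in> carrier_mat ?k ?k"
      "kmat cs cs (\<lambda>x y. (if x = y then t else 0) - q x y) * R = 1\<^sub>m ?k"
      by (auto simp: Units_def ring_mat_def)
    have "kmat cs cs (\<lambda>c d. if c = d then of_nat (card {x \<in> set xs. cl x = c}) else (0::'c)) =
      kmat cs cs (\<lambda>c d. if c = d then of_nat (card {x \<in> set xs'. cl' x = c}) else 0)"
      by (intro kmat_cong) (simp add: card)
    with *[OF xs cs(2) row R] *[OF xs' cs(3) row' R] ne eq show False by simp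
  qed
qed

lemma det_smult_one_add_mult_comm:
  fixes B :: "'a::field mat"
  assumes B: "B \<in> carrier_mat n m" and C: "C \<in> carrier_mat m n" and "\<zeta> \<noteq> 0"
  shows "\<zeta> ^ n * det (\<zeta> \<cdot>\<^sub>m 1\<^sub>m m + \<kappa> \<cdot>\<^sub>m (C * B)) = \<zeta> ^ m * det (\<zeta> \<cdot>\<^sub>m 1\<^sub>m n + \<kappa> \<cdot>\<^sub>m (B * C))"
proof -
  have "\<zeta> \<cdot>\<^sub>m 1\<^sub>m m + \<kappa> \<cdot>\<^sub>m (C * B) = \<zeta> \<cdot>\<^sub>m (1\<^sub>m m + C * ((\<kappa> / \<zeta>) \<cdot>\<^sub>m B))"
    using assms by (intro eq_matI) (auto simp: algebra_simps)
  moreover have "\<zeta> \<cdot>\<^sub>m 1\<^sub>m n + \<kappa> \<cdot>\<^sub>m (B * C) = \<zeta> \<cdot>\<^sub>m (1\<^sub>m n + ((\<kappa> / \<zeta>) \<cdot>\<^sub>m B) * C)"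
    using assms by (intro eq_matI) (auto simp: algebra_simps)
  moreover have "det (1\<^sub>m m + C * ((\<kappa> / \<zeta>) \<cdot>\<^sub>m B)) = det (1\<^sub>m n + ((\<kappa> / \<zeta>) \<cdot>\<^sub>m B) * C)"
    using assms by (intro det_one_add_mult_comm) auto
  ultimately show ?thesis using B C by (simp add: det_smult)
qed

lemma det_gram_block:
  fixes B :: "'a::field mat"
  assumes B: "B \<in> carrier_mat n m" and C: "C \<in> carrier_mat m n" and "\<alpha> \<noteq> 0"
  shows "det (four_block_mat (\<alpha> \<cdot>\<^sub>m 1\<^sub>m n) (\<beta> \<cdot>\<^sub>m B) (\<beta> \<cdot>\<^sub>m C) (\<zeta> \<cdot>\<^sub>m 1\<^sub>m m + \<theta> \<cdot>\<^sub>m (C * B))) =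
    \<alpha> ^ n * det (\<zeta> \<cdot>\<^sub>m 1\<^sub>m m + (\<theta> - \<beta>\<^sup>2 / \<alpha>) \<cdot>\<^sub>m (C * B))"
proof -
  let ?M = "four_block_mat (\<alpha> \<cdot>\<^sub>m 1\<^sub>m n) (\<beta> \<cdot>\<^sub>m B) (\<beta> \<cdot>\<^sub>m C) (\<zeta> \<cdot>\<^sub>m 1\<^sub>m m + \<theta> \<cdot>\<^sub>m (C * B))"
  let ?N = "four_block_mat (1\<^sub>m n) ((- \<beta> / \<alpha>) \<cdot>\<^sub>m B) (0\<^sub>m m n) (1\<^sub>m m)"
  let ?L = "four_block_mat (\<alpha> \<cdot>\<^sub>m 1\<^sub>m n) (0\<^sub>m n m) (\<beta> \<cdot>\<^sub>m C)
      (\<zeta> \<cdot>\<^sub>m 1\<^sub>m m + (\<theta> - \<beta>\<^sup>2 / \<alpha>) \<cdot>\<^sub>m (C * B))"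
  have car: "?M \<in> carrier_mat (n+m) (n+m)" "?N \<in> carrier_mat (n+m) (n+m)" using B C by auto
  have "?M * ?N = ?L"
  proof (subst mult_four_block_mat[of _ n n _ m _ m _ _ n _ m], goal_cases)
    case 9
    have "(\<alpha> \<cdot>\<^sub>m 1\<^sub>m n) * ((- \<beta> / \<alpha>) \<cdot>\<^sub>m B) = (- \<beta>) \<cdot>\<^sub>m B"
      using B \<open>\<alpha> \<noteq> 0\<close> by (subst mult_smult_assoc_mat[of _ n n _ m]) auto
    moreover have "(\<beta> \<cdot>\<^sub>m C) * ((- \<beta> / \<alpha>) \<cdot>\<^sub>m B) = (- \<beta>\<^sup>2 / \<alpha>) \<cdot>\<^sub>m (C * B)"
      using B C by (subst mult_smult_assoc_mat[of _ m n _ m])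
        (auto simp: mult_smult_distrib[of _ m n _ m] power2_eq_square)
    ultimately show ?case
      using B C by (auto intro!: cong_four_block_mat eq_matI simp: algebra_simps)
  qed (use B C in auto)
  then have "det ?L = det ?M * det ?N" using det_mult[OF car] by simp
  also have "det ?N = 1"
    using B by (subst det_four_block_mat_lower_left_zero[of _ n _ m]) auto
  also have "det ?L = \<alpha> ^ n * det (\<zeta> \<cdot>\<^sub>m 1\<^sub>m m + (\<theta> - \<beta>\<^sup>2 / \<alpha>) \<cdot>\<^sub>m (C * B))"
    using B C by (subst det_four_block_mat_upper_right_zero[of _ n _ m]) (auto simp: det_smult)
  finally show ?thesis by simp
qed

lemma det_smult_one_add_smult_cong:
  fixes A :: "'a::field mat"
  assumes A: "A \<in> carrier_mat n n" and B: "B \<in> carrier_mat n n" and "char_poly A = char_poly B"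
  shows "det (a \<cdot>\<^sub>m 1\<^sub>m n + b \<cdot>\<^sub>m A) = det (a \<cdot>\<^sub>m 1\<^sub>m n + b \<cdot>\<^sub>m B)"
proof (cases "b = 0")
  case True
  have "a \<cdot>\<^sub>m 1\<^sub>m n + b \<cdot>\<^sub>m A = a \<cdot>\<^sub>m 1\<^sub>m n + b \<cdot>\<^sub>m B"
    using A B True by (intro eq_matI) auto
  then show ?thesis by simp
next
  case False
  have "det (a \<cdot>\<^sub>m 1\<^sub>m n + b \<cdot>\<^sub>m A) = (- b) ^ n * poly (char_poly A) (- a / b)" if A: "A \<in> carrier_mat n n" for A
  proof -
    have "a \<cdot>\<^sub>m 1\<^sub>m n + b \<cdot>\<^sub>m A = (- b) \<cdot>\<^sub>m (- char_matrix A (- a / b))"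
      using A False by (intro eq_matI) (auto simp: char_matrix_def field_simps)
    moreover have "dim_col (char_matrix A (- a / b)) = n" using A by (simp add: char_matrix_def)
    ultimately show ?thesis unfolding char_poly_matrix[OF A] using A by (simp add: det_smult)
  qed
  with A B assms(3) show ?thesis by simp
qed

section \<open>Spectra, distances and isomorphisms of graphs\<close>

lemma char_poly_eq_prod_proots:
  fixes A :: "complex mat"
  assumes "A \<in> carrier_mat n n"
  shows "char_poly A = (\<Prod>a\<in>#proots (char_poly A). [:- a, 1:])"
proof -
  obtain as where as: "char_poly A = (\<Prod>a\<leftarrow>as. [:- a, 1:])"
    using char_poly_factorized[OF assms] by blast
  have "proots (\<Prod>a\<leftarrow>as. [:- a, 1:]) = mset as" for as :: "complex list"
  proof (induction as)
    case (Cons a as)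
    have "(\<Prod>a\<leftarrow>as. [:- a, 1:]) \<noteq> 0" by (auto simp: prod_list_zero_iff)
    then have "proots ([:- a, 1:] * (\<Prod>a\<leftarrow>as. [:- a, 1:])) = {#a#} + mset as"
      by (subst proots_mult) (simp_all add: Cons.IH del: mult_pCons_left)
    then show ?case by simp
  qed simp
  then show ?thesis unfolding as by (simp flip: prod_mset_prod_list)
qed

lemma eigenvalue_mset_eq_iff:
  assumes A: "A \<in> carrier_mat n n" and B: "B \<in> carrier_mat m m"
  shows "eigenvalue_mset A = eigenvalue_mset B \<longleftrightarrow> char_poly A = char_poly B"
proof -
  have inj: "p = q" if "map_poly complex_of_real p = map_poly complex_of_real q" for p q
  proof (rule poly_eqI)
    fix i
    have "coeff (map_poly complex_of_real p) i = coeff (map_poly complex_of_real q) i"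
      using that by simp
    then show "coeff p i = coeff q i" by (simp add: coeff_map_poly)
  qed
  have "eigenvalue_mset A = eigenvalue_mset B \<longleftrightarrow>
      char_poly (map_mat complex_of_real A) = char_poly (map_mat complex_of_real B)"
    unfolding eigenvalue_mset_def
    using char_poly_eq_prod_proots[of "map_mat complex_of_real A" n]
      char_poly_eq_prod_proots[of "map_mat complex_of_real B" m] A B by auto
  then show ?thesis
    using inj by (auto simp: of_real_hom.char_poly_hom[OF A] of_real_hom.char_poly_hom[OF B])
qed

lemma eigenvalue_kmat_row_sum:
  fixes f :: "'a \<Rightarrow> 'a \<Rightarrow> 'b::field"
  assumes "distinct xs" "xs \<noteq> []" and row: "\<And>x. x \<in> set xs \<Longrightarrow> (\<Sum>y\<in>set xs. f x y) = r"
  shows "eigenvalue (kmat xs xs f) r"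
  unfolding eigenvalue_def
proof
  let ?v = "vec (length xs) (\<lambda>_. 1 :: 'b)"
  have "?v \<noteq> 0\<^sub>v (length xs)"
    using assms(2) by (metis index_vec index_zero_vec(1) length_greater_0_conv zero_neq_one)
  moreover have "kmat xs xs f *\<^sub>v ?v = r \<cdot>\<^sub>v ?v"
  proof (rule eq_vecI)
    fix i assume "i < dim_vec (r \<cdot>\<^sub>v ?v)"
    then have i: "i < length xs" by simp
    have "(\<Sum>y\<in>set xs. f (xs ! i) y) = (\<Sum>k<length xs. f (xs ! i) (xs ! k))"
      by (rule sum.reindex_bij_betw[symmetric], rule bij_betw_nth[OF assms(1)]) auto
    with i row[of "xs ! i"] show "(kmat xs xs f *\<^sub>v ?v) $ i = (r \<cdot>\<^sub>v ?v) $ i"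
      by (simp add: scalar_prod_def atLeast0LessThan)
  qed simp
  ultimately show "eigenvector (kmat xs xs f) ?v r"
    by (simp add: eigenvector_def)
qed

lemma eigenvalue_kmat_abs_le:
  fixes f :: "'a \<Rightarrow> 'a \<Rightarrow> real"
  assumes "distinct xs" and row: "\<And>x. x \<in> set xs \<Longrightarrow> (\<Sum>y\<in>set xs. f x y) = r"
    and nonneg: "\<And>x y. 0 \<le> f x y" and ev: "eigenvalue (kmat xs xs f) \<mu>"
  shows "\<bar>\<mu>\<bar> \<le> r"
proof -
  from ev obtain v where v: "v \<in> carrier_vec (length xs)" "v \<noteq> 0\<^sub>v (length xs)"
    "kmat xs xs f *\<^sub>v v = \<mu> \<cdot>\<^sub>v v"
    by (auto simp: eigenvalue_def eigenvector_def)
  obtain j where j: "j < length xs" "v $ j \<noteq> 0"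
    using v(1,2) by (metis carrier_vecD eq_vecI index_zero_vec)
  define M where "M = Max ((\<lambda>i. \<bar>v $ i\<bar>) ` {..<length xs})"
  have le: "\<bar>v $ i\<bar> \<le> M" if "i < length xs" for i
    unfolding M_def using that by (intro Max_ge) auto
  have "M \<in> (\<lambda>i. \<bar>v $ i\<bar>) ` {..<length xs}"
    unfolding M_def using j by (intro Max_in) auto
  then obtain i where i: "i < length xs" "M = \<bar>v $ i\<bar>" by auto
  have "M > 0" using le[OF j(1)] j(2) by linarith
  have "(\<Sum>y\<in>set xs. f (xs ! i) y) = (\<Sum>k<length xs. f (xs ! i) (xs ! k))"
    by (rule sum.reindex_bij_betw[symmetric], rule bij_betw_nth[OF assms(1)]) auto
  then have sum: "(\<Sum>k<length xs. f (xs ! i) (xs ! k)) = r" using row i by simp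
  have "\<mu> * v $ i = (kmat xs xs f *\<^sub>v v) $ i" using v i by simp
  also have "\<dots> = (\<Sum>k<length xs. f (xs ! i) (xs ! k) * v $ k)"
    using v(1) i by (simp add: scalar_prod_def atLeast0LessThan)
  finally have "\<bar>\<mu>\<bar> * M = \<bar>\<Sum>k<length xs. f (xs ! i) (xs ! k) * v $ k\<bar>"
    using i by (simp flip: abs_mult)
  also have "\<dots> \<le> (\<Sum>k<length xs. f (xs ! i) (xs ! k) * M)"
    by (rule order_trans[OF sum_abs], rule sum_mono)
      (auto simp: abs_mult nonneg intro!: mult_left_mono le)
  also have "\<dots> = r * M" using sum by (simp flip: sum_distrib_right)
  finally show ?thesis using \<open>M > 0\<close> by simp
qed

lemma vertex_list:
  assumes "finite (pverts G)"
  shows "distinct (vertex_list G)" "set (vertex_list G) = pverts G"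
proof -
  have "\<exists>vs. distinct vs \<and> set vs = pverts G"
    using finite_distinct_list[OF assms] by blast
  then have "distinct (vertex_list G) \<and> set (vertex_list G) = pverts G"
    unfolding vertex_list_def by (rule someI_ex)
  then show "distinct (vertex_list G)" "set (vertex_list G) = pverts G" by auto
qed

lemma vertex_matrix_eq_kmat:
  assumes "finite (pverts G)"
  shows "vertex_matrix G f = kmat (vertex_list G) (vertex_list G) f"
proof -
  have "length (vertex_list G) = card (pverts G)"
    using vertex_list[OF assms] by (metis distinct_card)
  then show ?thesis by (simp add: vertex_matrix_def kmat_def)
qed

lemma char_poly_vertex_matrix:
  assumes "distinct xs" "set xs = pverts G"
  shows "char_poly (vertex_matrix G f) = char_poly (kmat xs xs f)"
proof -
  have fin: "finite (pverts G)" using assms(2) by (metis List.finite_set)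
  show ?thesis
    unfolding vertex_matrix_eq_kmat[OF fin]
    by (rule char_poly_kmat_set_eq) (use vertex_list[OF fin] assms in auto)
qed

lemma vertex_matrix_carrier [simp]:
  "vertex_matrix G f \<in> carrier_mat (card (pverts G)) (card (pverts G))"
  by (simp add: vertex_matrix_def)

lemma (in wf_digraph) potential_le_length_awalk:
  fixes d :: "'a \<Rightarrow> nat"
  assumes "awalk x p z" and "d z = 0"
    and step: "\<And>e. e \<in> arcs G \<Longrightarrow> d (tail G e) \<le> Suc (d (head G e))"
  shows "d x \<le> length p"
  using assms(1)
proof (induction p arbitrary: x)
  case Nil
  then show ?case using assms(2) by (auto simp: awalk_Nil_iff)
next
  case (Cons e p)
  then have "e \<in> arcs G" "tail G e = x" "d (head G e) \<le> length p"
    by (auto simp: awalk_Cons_iff)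
  then show ?case using step[of e] by simp
qed

lemma (in wf_digraph) awalk_of_potential:
  fixes d :: "'a \<Rightarrow> nat"
  assumes "x \<in> verts G" "z \<in> verts G" and "d z = 0"
    and down: "\<And>x. x \<in> verts G \<Longrightarrow> x \<noteq> z \<Longrightarrow>
      \<exists>e\<in>arcs G. tail G e = x \<and> d x = Suc (d (head G e))"
  shows "\<exists>p. awalk x p z \<and> length p = d x"
  using assms(1)
proof (induction "d x" arbitrary: x rule: less_induct)
  case less
  show ?case
  proof (cases "x = z")
    case True
    then show ?thesis using assms by (intro exI[of _ "[]"]) (auto simp: awalk_Nil_iff)
  next
    case False
    with down less.prems obtain e where e: "e \<in> arcs G" "tail G e = x" "d x = Suc (d (head G e))"
      by blast
    with less.hyps[of "head G e"] obtain p where "awalk (head G e) p z" "length p = d (head G e)"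
      by auto
    with e show ?thesis by (intro exI[of _ "e # p"]) (auto simp: awalk_Cons_iff)
  qed
qed

lemma (in wf_digraph) \<mu>_unit_cost_eq_potential:
  fixes d :: "'a \<Rightarrow> nat"
  assumes "x \<in> verts G" "z \<in> verts G" and "d z = 0"
    and step: "\<And>e. e \<in> arcs G \<Longrightarrow> d (tail G e) \<le> Suc (d (head G e))"
    and down: "\<And>x. x \<in> verts G \<Longrightarrow> x \<noteq> z \<Longrightarrow>
      \<exists>e\<in>arcs G. tail G e = x \<and> d x = Suc (d (head G e))"
  shows "\<mu> (\<lambda>_. 1) x z = ereal (d x)"
proof (rule antisym)
  have cost: "awalk_cost (\<lambda>_. 1) p = length p" for p
    by (simp add: awalk_cost_def sum_list_triv)
  obtain p where "awalk x p z" "length p = d x"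
    using awalk_of_potential[of x z d] assms by blast
  then show "\<mu> (\<lambda>_. 1) x z \<le> ereal (d x)"
    using min_cost_le_walk_cost[of x p z "\<lambda>_. 1"] by (simp add: cost)
  show "ereal (d x) \<le> \<mu> (\<lambda>_. 1) x z"
    unfolding \<mu>_def using potential_le_length_awalk[of x _ z d] assms(3) step
    by (intro INF_greatest) (simp add: cost)
qed

lemma graph_dist_eq_potential:
  assumes "wf_digraph (with_proj G)" and "x \<in> pverts G" "z \<in> pverts G" and "d z = 0"
    and "\<And>u v. (u, v) \<in> parcs G \<Longrightarrow> d u \<le> Suc (d v)"
    and "\<And>x. x \<in> pverts G \<Longrightarrow> x \<noteq> z \<Longrightarrow> \<exists>y. (x, y) \<in> parcs G \<and> d x = Suc (d y)"
  shows "graph_dist G x z = d x"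
proof -
  interpret wf_digraph "with_proj G" by fact
  have "\<mu> (\<lambda>_. 1) x z = ereal (d x)"
  proof (rule \<mu>_unit_cost_eq_potential)
    fix x assume "x \<in> verts (with_proj G)" "x \<noteq> z"
    then obtain y where "(x, y) \<in> parcs G" "d x = Suc (d y)" using assms(6)[of x] by auto
    then show "\<exists>e\<in>arcs (with_proj G). tail (with_proj G) e = x \<and> d x = Suc (d (head (with_proj G) e))"
      by (intro bexI[of _ "(x, y)"]) auto
  qed (use assms(2-5) in auto)
  then show ?thesis by (simp add: graph_dist_def)
qed

lemma digraph_iso_iff:
  assumes G: "wf_digraph (with_proj G)" and H: "wf_digraph (with_proj H)"
  shows "digraph_iso (with_proj G) (with_proj H) \<longleftrightarrow>
    (\<exists>f. bij_betw f (pverts G) (pverts H) \<and>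
      (\<forall>u\<in>pverts G. \<forall>v\<in>pverts G. (u, v) \<in> parcs G \<longleftrightarrow> (f u, f v) \<in> parcs H))"
    (is "?L \<longleftrightarrow> ?R")
proof
  have Gv: "u \<in> pverts G" "v \<in> pverts G" if "(u, v) \<in> parcs G" for u v
    using that wf_digraph.wellformed[OF G, of "(u, v)"] by auto
  have Hv: "u \<in> pverts H" "v \<in> pverts H" if "(u, v) \<in> parcs H" for u v
    using that wf_digraph.wellformed[OF H, of "(u, v)"] by auto
  show ?R if ?L
  proof -
    from that obtain h where h: "pre_digraph.digraph_isomorphism (with_proj G) h"
      "with_proj H = app_iso h (with_proj G)" by (auto simp: digraph_iso_def)
    let ?f = "iso_verts h"
    from h(1) have inj: "inj_on ?f (pverts G)"
      and hh: "\<And>u v. (u, v) \<in> parcs G \<Longrightarrow> iso_tail h (iso_arcs h (u, v)) = ?f u \<and> iso_head h (iso_arcs h (u, v)) = ?f v"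
      by (auto simp: pre_digraph.digraph_isomorphism_def)
    from h(2) have eqs: "pverts H = ?f ` pverts G" "parcs H = iso_arcs h ` parcs G"
      "iso_tail h = fst" "iso_head h = snd"
      by (simp_all add: with_proj_def app_iso_def)
    have arc: "iso_arcs h (u, v) = (?f u, ?f v)" if "(u, v) \<in> parcs G" for u v
      using hh[OF that] by (simp add: eqs prod_eq_iff)
    have "(u, v) \<in> parcs G \<longleftrightarrow> (?f u, ?f v) \<in> parcs H" if "u \<in> pverts G" "v \<in> pverts G" for u v
    proof
      assume "(?f u, ?f v) \<in> parcs H"
      then obtain u' v' where "(u', v') \<in> parcs G" "(?f u, ?f v) = (?f u', ?f v')"
        unfolding eqs(2) using arc by auto
      moreover from this have "u = u'" "v = v'"
        using inj that Gv[of u' v'] by (auto dest: inj_onD)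
      ultimately show "(u, v) \<in> parcs G" by simp
    qed (use arc in \<open>force simp: eqs\<close>)
    then show ?R using inj eqs by (intro exI[of _ ?f]) (auto simp: bij_betw_def)
  qed
  show ?L if ?R
  proof -
    from that obtain f where f: "bij_betw f (pverts G) (pverts H)"
      "\<And>u v. u \<in> pverts G \<Longrightarrow> v \<in> pverts G \<Longrightarrow> (u, v) \<in> parcs G \<longleftrightarrow> (f u, f v) \<in> parcs H" by blast
    let ?h = "\<lparr>iso_verts = f, iso_arcs = map_prod f f, iso_head = snd, iso_tail = fst\<rparr>"
    have inj: "inj_on f (pverts G)" and im: "f ` pverts G = pverts H"
      using f(1) by (auto simp: bij_betw_def)
    have "inj_on (map_prod f f) (parcs G)"
      using map_prod_inj_on[OF inj inj] by (rule inj_on_subset) (use Gv in auto)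
    then have "pre_digraph.digraph_isomorphism (with_proj G) ?h"
      using inj G by (auto simp: pre_digraph.digraph_isomorphism_def)
    moreover have "parcs H = map_prod f f ` parcs G"
    proof (intro equalityI subsetI)
      fix e assume e: "e \<in> parcs H"
      then have "fst e \<in> f ` pverts G" "snd e \<in> f ` pverts G"
        unfolding im using Hv[of "fst e" "snd e"] by auto
      then obtain u v where "u \<in> pverts G" "v \<in> pverts G" "e = (f u, f v)"
        by (metis imageE prod.collapse)
      with e f(2)[of u v] show "e \<in> map_prod f f ` parcs G"
        by (intro image_eqI[of _ _ "(u, v)"]) auto
    next
      fix e assume "e \<in> map_prod f f ` parcs G"
      then obtain u v where uv: "(u, v) \<in> parcs G" and e: "e = (f u, f v)" by auto
      show "e \<in> parcs H" using f(2)[OF Gv[OF uv]] uv e by simp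
    qed
    then have "with_proj H = app_iso ?h (with_proj G)"
      using im by (simp add: with_proj_def app_iso_def)
    ultimately show ?L unfolding digraph_iso_def by blast
  qed
qed

section \<open>Regular graphs\<close>

lemma psubset_iff_card_less: "finite B \<Longrightarrow> A \<subseteq> B \<Longrightarrow> A \<subset> B \<longleftrightarrow> card A < card B"
  by (auto intro: psubset_card_mono)

locale regular_simple_graph =
  fixes G :: "'a pair_pre_digraph" and r :: nat
  assumes finite_verts: "finite (pverts G)"
    and verts_nonempty: "pverts G \<noteq> {}"
    and arc_fst: "(u, v) \<in> parcs G \<Longrightarrow> u \<in> pverts G"
    and arc_sym: "(u, v) \<in> parcs G \<Longrightarrow> (v, u) \<in> parcs G"
    and arc_irrefl: "(u, u) \<notin> parcs G"
    and card_neighbours: "v \<in> pverts G \<Longrightarrow> card (parcs G `` {v}) = r"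
begin

lemma arc_snd: "(u, v) \<in> parcs G \<Longrightarrow> v \<in> pverts G"
  using arc_fst arc_sym by blast

lemma wf: "wf_digraph (with_proj G)"
  by unfold_locales (use arc_fst arc_snd in auto)

lemma neighbours_subset: "parcs G `` {v} \<subseteq> pverts G - {v}"
  using arc_snd[of v] arc_irrefl[of v] by auto

lemma finite_neighbours: "finite (parcs G `` {v})"
  using neighbours_subset by (rule finite_subset) (simp add: finite_verts)

lemma edge_setE:
  assumes "e \<in> edge_set G"
  obtains u v where "e = {u, v}" "u \<noteq> v" "(u, v) \<in> parcs G" "u \<in> pverts G" "v \<in> pverts G"
proof -
  from assms obtain u v where "e = {u, v}" "(u, v) \<in> parcs G" by (auto simp: edge_set_def)
  moreover from this have "u \<noteq> v" using arc_irrefl by auto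
  ultimately show thesis using that arc_fst arc_snd by blast
qed

lemma doubleton_edge_iff: "{u, v} \<in> edge_set G \<longleftrightarrow> (u, v) \<in> parcs G"
proof
  assume "{u, v} \<in> edge_set G"
  then obtain a b where "{u, v} = {a, b}" "(a, b) \<in> parcs G" by (auto simp: edge_set_def)
  then show "(u, v) \<in> parcs G" using arc_sym[of a b] by (auto simp: doubleton_eq_iff)
qed (auto simp: edge_set_def)

lemma edge_subset: "e \<in> edge_set G \<Longrightarrow> e \<subseteq> pverts G"
  by (erule edge_setE) auto

lemma finite_edge_set: "finite (edge_set G)"
  by (rule finite_subset[of _ "Pow (pverts G)"]) (use edge_subset in \<open>blast, simp add: finite_verts\<close>)

lemma card_edge: "e \<in> edge_set G \<Longrightarrow> card e = 2"
  by (erule edge_setE) auto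

lemma edge_eqI:
  assumes "e \<in> edge_set G" "u \<in> e" "v \<in> e" "u \<noteq> v"
  shows "e = {u, v}"
  using assms by (elim edge_setE) auto

lemma card_incident_edges:
  assumes "v \<in> pverts G"
  shows "card {e \<in> edge_set G. v \<in> e} = r"
proof -
  have "{e \<in> edge_set G. v \<in> e} = (\<lambda>u. {v, u}) ` (parcs G `` {v})"
  proof (intro equalityI subsetI)
    fix e assume "e \<in> {e \<in> edge_set G. v \<in> e}"
    then obtain a b where "e = {a, b}" "(a, b) \<in> parcs G" "v = a \<or> v = b"
      by (auto elim: edge_setE)
    then show "e \<in> (\<lambda>u. {v, u}) ` (parcs G `` {v})" using arc_sym by (auto simp: insert_commute)
  qed (auto simp: doubleton_edge_iff)
  moreover have "inj_on (\<lambda>u. {v, u}) (parcs G `` {v})"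
    by (auto simp: inj_on_def doubleton_eq_iff)
  ultimately show ?thesis using card_neighbours[OF assms] by (simp add: card_image)
qed

lemma sum_card_Int_edges:
  assumes "A \<subseteq> pverts G"
  shows "(\<Sum>e\<in>edge_set G. card (A \<inter> e)) = card A * r"
proof -
  have fin: "finite A" using assms finite_verts by (rule finite_subset)
  have "(\<Sum>e\<in>edge_set G. card (A \<inter> e)) = (\<Sum>e\<in>edge_set G. \<Sum>v\<in>A. if v \<in> e then 1 else 0)"
    using fin by (simp add: sum.If_cases Int_def)
  also have "\<dots> = (\<Sum>v\<in>A. \<Sum>e\<in>edge_set G. if v \<in> e then 1 else 0)" by (rule sum.swap)
  also have "\<dots> = (\<Sum>v\<in>A. r)"
    using assms by (intro sum.cong) (auto simp: sum.If_cases finite_edge_set Int_def card_incident_edges)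
  finally show ?thesis by simp
qed

lemma handshake: "2 * card (edge_set G) = card (pverts G) * r"
proof -
  have "(\<Sum>e\<in>edge_set G. card (pverts G \<inter> e)) = (\<Sum>e\<in>edge_set G. 2)"
    by (intro sum.cong) (auto simp: Int_absorb1 edge_subset card_edge)
  then show ?thesis using sum_card_Int_edges[of "pverts G"] by simp
qed

lemma card_edge_set: "card (edge_set G) = card (pverts G) * r div 2"
  using handshake by simp

lemma sum_incidence_mult:
  assumes "u \<in> pverts G" "v \<in> pverts G"
  shows "(\<Sum>e\<in>edge_set G. of_bool (u \<in> e) * of_bool (v \<in> e)) =
    (if u = v then real r else 0) + of_bool ((u, v) \<in> parcs G)"
proof -
  have "(\<Sum>e\<in>edge_set G. of_bool (u \<in> e) * of_bool (v \<in> e)) = real (card {e \<in> edge_set G. u \<in> e \<and> v \<in> e})"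
    using finite_edge_set by (simp flip: of_bool_conj add: sum_of_bool_eq Int_def)
  also have "\<dots> = (if u = v then real r else 0) + of_bool ((u, v) \<in> parcs G)"
  proof (cases "u = v")
    case True
    then show ?thesis using card_incident_edges[OF assms(1)] arc_irrefl by simp
  next
    case False
    have "e \<in> edge_set G \<and> u \<in> e \<and> v \<in> e \<longleftrightarrow> e = {u, v} \<and> (u, v) \<in> parcs G" for e
      using edge_eqI[of e u v] False doubleton_edge_iff[of u v] by auto
    then have "{e \<in> edge_set G. u \<in> e \<and> v \<in> e} = (if (u, v) \<in> parcs G then {{u, v}} else {})"
      by auto
    with False show ?thesis by simp
  qed
  finally show ?thesis .
qed

lemma edge_avoiding_vertex_iff:
  assumes "v \<in> pverts G"
  shows "(\<exists>e\<in>edge_set G. v \<notin> e) \<longleftrightarrow> r < card (edge_set G)"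
proof -
  have "(\<exists>e\<in>edge_set G. v \<notin> e) \<longleftrightarrow> {e \<in> edge_set G. v \<in> e} \<subset> edge_set G" by auto
  also have "\<dots> \<longleftrightarrow> card {e \<in> edge_set G. v \<in> e} < card (edge_set G)"
    using finite_edge_set by (intro psubset_iff_card_less) auto
  finally show ?thesis unfolding card_incident_edges[OF assms] .
qed

lemma disjoint_edge_iff:
  assumes "e \<in> edge_set G"
  shows "(\<exists>f\<in>edge_set G. e \<inter> f = {}) \<longleftrightarrow> 2 * r < Suc (card (edge_set G))"
proof -
  obtain u v where e: "e = {u, v}" "u \<noteq> v" "u \<in> pverts G" "v \<in> pverts G"
    using edge_setE[OF assms] .
  let ?U = "{f \<in> edge_set G. u \<in> f}" and ?V = "{f \<in> edge_set G. v \<in> f}"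
  have fin: "finite ?U" "finite ?V" using finite_edge_set by auto
  have "f \<in> ?U \<inter> ?V \<longleftrightarrow> f = e" for f
    using edge_eqI[of f u v] e assms by auto
  then have "?U \<inter> ?V = {e}" by blast
  then have card: "2 * r = Suc (card (?U \<union> ?V))"
    using card_Un_Int[OF fin] card_incident_edges e by simp
  have "(\<exists>f\<in>edge_set G. e \<inter> f = {}) \<longleftrightarrow> ?U \<union> ?V \<subset> edge_set G" unfolding e by auto
  also have "\<dots> \<longleftrightarrow> card (?U \<union> ?V) < card (edge_set G)"
    using finite_edge_set by (intro psubset_iff_card_less) auto
  finally show ?thesis unfolding card by simp
qed

lemma vertex_outside_edge_iff:
  assumes "e \<in> edge_set G"
  shows "(\<exists>v\<in>pverts G. v \<notin> e) \<longleftrightarrow> 2 < card (pverts G)"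
proof -
  have "(\<exists>v\<in>pverts G. v \<notin> e) \<longleftrightarrow> e \<subset> pverts G" using edge_subset[OF assms] by auto
  also have "\<dots> \<longleftrightarrow> card e < card (pverts G)"
    using finite_verts edge_subset[OF assms] by (rule psubset_iff_card_less)
  finally show ?thesis unfolding card_edge[OF assms] .
qed

lemma other_vertex_iff:
  assumes "v \<in> pverts G"
  shows "(\<exists>u\<in>pverts G. u \<noteq> v) \<longleftrightarrow> 1 < card (pverts G)"
proof -
  have "(\<exists>u\<in>pverts G. u \<noteq> v) \<longleftrightarrow> {v} \<subset> pverts G" using assms by auto
  also have "\<dots> \<longleftrightarrow> card {v} < card (pverts G)"
    using finite_verts assms by (intro psubset_iff_card_less) auto
  finally show ?thesis by simp
qed

lemma nonneighbour_iff:
  assumes "v \<in> pverts G"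
  shows "(\<exists>u\<in>pverts G. u \<noteq> v \<and> (v, u) \<notin> parcs G) \<longleftrightarrow> Suc r < card (pverts G)"
proof -
  have sub: "insert v (parcs G `` {v}) \<subseteq> pverts G" using neighbours_subset assms by blast
  then have "(\<exists>u\<in>pverts G. u \<noteq> v \<and> (v, u) \<notin> parcs G) \<longleftrightarrow> insert v (parcs G `` {v}) \<subset> pverts G"
    by auto
  also have "\<dots> \<longleftrightarrow> card (insert v (parcs G `` {v})) < card (pverts G)"
    using finite_verts sub by (rule psubset_iff_card_less)
  also have "card (insert v (parcs G `` {v})) = Suc r"
    using card_neighbours[OF assms] finite_neighbours arc_irrefl by simp
  finally show ?thesis .
qed

lemma degree_less_card: "r < card (pverts G)"
proof -
  obtain v where v: "v \<in> pverts G" using verts_nonempty by auto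
  then have "card (parcs G `` {v}) < card (pverts G)"
    using neighbours_subset by (intro psubset_card_mono finite_verts) auto
  then show ?thesis using card_neighbours[OF v] by simp
qed

lemma arc_iff_if_complete:
  assumes "Suc r = card (pverts G)" "u \<in> pverts G" "v \<in> pverts G"
  shows "(u, v) \<in> parcs G \<longleftrightarrow> u \<noteq> v"
  using nonneighbour_iff[OF assms(2)] assms(1,3) arc_irrefl[of u] by (cases "u = v") auto

end

lemma regular_simple_graph_if_connected:
  assumes "connected_graph G" "regular_graph G"
  obtains r where "regular_simple_graph G r"
proof -
  interpret pair_graph G using assms(1) by (simp add: connected_graph_def)
  obtain r where r: "\<And>v. v \<in> pverts G \<Longrightarrow> out_degree G v = r"
    using assms(2) by (auto simp: regular_graph_def)
  have sym: "(v, u) \<in> parcs G" if "(u, v) \<in> parcs G" for u v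
    using that pair_sym_arcs by (auto simp: symmetric_def dest: symD)
  have "pverts G \<noteq> {}"
    using assms(1) by (auto simp: connected_graph_def connected_conv)
  moreover have "(u, u) \<notin> parcs G" for u
    using pair_no_loops[of "(u, u)"] by auto
  moreover have "out_degree G v = card (parcs G `` {v})" for v
  proof -
    have "parcs G `` {v} = snd ` out_arcs G v" by (force simp: out_arcs_def)
    moreover have "inj_on snd (out_arcs G v)" by (auto simp: inj_on_def out_arcs_def)
    ultimately show ?thesis by (simp add: out_degree_def card_image)
  qed
  ultimately have "regular_simple_graph G r"
    using r sym by unfold_locales (auto simp: in_arcsD1)
  then show thesis by (rule that)
qed

lemma connected_graph_closed_eq:
  assumes "connected_graph G" and "S \<subseteq> pverts G" "S \<noteq> {}"
    and closed: "\<And>u v. u \<in> S \<Longrightarrow> (u, v) \<in> parcs G \<Longrightarrow> v \<in> S"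
  shows "S = pverts G"
proof -
  interpret pair_graph G using assms(1) by (simp add: connected_graph_def)
  have "strongly_connected (with_proj G)"
    using assms(1) symmetric_connected_imp_strongly_connected pair_sym_arcs
    by (simp add: connected_graph_def)
  obtain u where "u \<in> S" using assms(3) by auto
  have "v \<in> S" if "v \<in> pverts G" for v
  proof -
    have "u \<rightarrow>\<^sup>*\<^bsub>with_proj G\<^esub> v"
      using \<open>strongly_connected (with_proj G)\<close> that \<open>u \<in> S\<close> assms(2) by (auto simp: strongly_connected_def)
    then have "(u, v) \<in> (parcs G)\<^sup>*"
      using reachable_rtranclI[of "with_proj G" u v] by simp
    then show "v \<in> S"
      by (induction rule: rtrancl_induct) (use \<open>u \<in> S\<close> closed in auto)
  qed
  then show ?thesis using assms(2) by auto
qed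

context regular_simple_graph
begin

lemma card_verts_if_degree_le_1:
  assumes "connected_graph G" "r \<le> 1"
  shows "card (pverts G) = Suc r"
proof -
  obtain v where v: "v \<in> pverts G" using verts_nonempty by auto
  let ?S = "insert v (parcs G `` {v})"
  have card: "card ?S = Suc r"
    using card_neighbours[OF v] finite_neighbours arc_irrefl by simp
  have "b \<in> ?S" if "a \<in> ?S" "(a, b) \<in> parcs G" for a b
  proof (cases "a = v")
    case False
    with that have "v \<in> parcs G `` {a}" "b \<in> parcs G `` {a}" using arc_sym by auto
    moreover have "card (parcs G `` {a}) \<le> 1"
      using card_neighbours[of a] arc_fst[OF that(2)] assms(2) by simp
    ultimately have "b = v"
      using card_le_Suc0_iff_eq[OF finite_neighbours, of a] by auto
    then show ?thesis by simp
  qed (use that in auto)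
  then have "?S = pverts G"
    using v arc_snd by (intro connected_graph_closed_eq[OF assms(1)]) auto
  with card show ?thesis by simp
qed

end

section \<open>Distances in the subdivision-vertex join\<close>

fun join_dist :: "'b pair_pre_digraph \<Rightarrow> ('a + 'a set) + 'b \<Rightarrow> ('a + 'a set) + 'b \<Rightarrow> nat" where
  "join_dist H (Inl (Inl u)) (Inl (Inl v)) = (if u = v then 0 else 2)"
| "join_dist H (Inl (Inl u)) (Inl (Inr e)) = (if u \<in> e then 1 else 3)"
| "join_dist H (Inl (Inr e)) (Inl (Inl u)) = (if u \<in> e then 1 else 3)"
| "join_dist H (Inl (Inr e)) (Inl (Inr f)) = (if e = f then 0 else if e \<inter> f = {} then 4 else 2)"
| "join_dist H (Inl (Inl u)) (Inr w) = 1"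
| "join_dist H (Inr w) (Inl (Inl u)) = 1"
| "join_dist H (Inl (Inr e)) (Inr w) = 2"
| "join_dist H (Inr w) (Inl (Inr e)) = 2"
| "join_dist H (Inr w) (Inr z) = (if w = z then 0 else if (w, z) \<in> parcs H then 1 else 2)"

fun join_class :: "('a + 'e) + 'b \<Rightarrow> nat" where
  "join_class (Inl (Inl u)) = 0"
| "join_class (Inl (Inr e)) = 1"
| "join_class (Inr w) = 2"

text \<open>
  The set of distances from a vertex of class \<open>i\<close>; \<open>m\<close> is the number of edges of \<open>G\<close>, by the handshake
  lemma. Distance 3 from a vertex needs an edge avoiding it, and an edge has at least one disjoint edge
  iff \<open>m\<close> exceeds the number \<open>2 r - 1\<close> of edges that meet it.
\<close>

definition join_dists :: "nat \<Rightarrow> nat \<Rightarrow> nat \<Rightarrow> nat \<Rightarrow> nat \<Rightarrow> nat set" where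
  "join_dists n r k s i = (let m = n * r div 2 in
    if i = 0 then {0, 1} \<union> (if 1 < n then {2} else {}) \<union> (if r < m then {3} else {})
    else if i = 1 then {0, 1, 2} \<union> (if 2 < n then {3} else {}) \<union> (if 2 * r < Suc m then {4} else {})
    else {0, 1} \<union> (if 0 < m \<or> Suc s < k then {2} else {}))"

lemma join_vertex_cases:
  obtains (vertex) u where "x = Inl (Inl u)" | (edge) e where "x = Inl (Inr e)" | (right) w where "x = Inr w"
  by (metis obj_sumE)

lemma image_if:
  "(\<lambda>x. if P x then a else f x) ` A =
     (if \<exists>x\<in>A. P x then {a} else {}) \<union> f ` {x \<in> A. \<not> P x}"
  by auto

lemma image_const_Collect:
  "(\<lambda>x. c) ` {x \<in> A. P x} = (if \<exists>x\<in>A. P x then {c} else {})"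
  by auto

locale regular_join = G: regular_simple_graph G r + H: regular_simple_graph H s
  for G :: "'a pair_pre_digraph" and r :: nat and H :: "'b pair_pre_digraph" and s :: nat
begin

abbreviation J :: "(('a + 'a set) + 'b) pair_pre_digraph" where
  "J \<equiv> subdivision_vertex_join G H"

lemma verts_J:
  "pverts J = Inl ` Inl ` pverts G \<union> Inl ` Inr ` edge_set G \<union> Inr ` pverts H"
  by (auto simp: subdivision_vertex_join_def subdivision_graph_def)

lemma in_verts_J [simp]:
  "Inl (Inl u) \<in> pverts J \<longleftrightarrow> u \<in> pverts G"
  "Inl (Inr e) \<in> pverts J \<longleftrightarrow> e \<in> edge_set G"
  "Inr w \<in> pverts J \<longleftrightarrow> w \<in> pverts H"
  by (auto simp: verts_J)

lemma in_arcs_J [simp]: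
  "(Inl (Inl u), Inl (Inl v)) \<notin> parcs J"
  "(Inl (Inl u), Inl (Inr e)) \<in> parcs J \<longleftrightarrow> e \<in> edge_set G \<and> u \<in> e"
  "(Inl (Inr e), Inl (Inl u)) \<in> parcs J \<longleftrightarrow> e \<in> edge_set G \<and> u \<in> e"
  "(Inl (Inr e), Inl (Inr f)) \<notin> parcs J"
  "(Inl (Inl u), Inr w) \<in> parcs J \<longleftrightarrow> u \<in> pverts G \<and> w \<in> pverts H"
  "(Inr w, Inl (Inl u)) \<in> parcs J \<longleftrightarrow> u \<in> pverts G \<and> w \<in> pverts H"
  "(Inl (Inr e), Inr w) \<notin> parcs J"
  "(Inr w, Inl (Inr e)) \<notin> parcs J"
  "(Inr w, Inr z) \<in> parcs J \<longleftrightarrow> (w, z) \<in> parcs H"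
  by (auto simp: subdivision_vertex_join_def subdivision_graph_def)

lemma arc_J_verts:
  assumes "(x, y) \<in> parcs J"
  shows "x \<in> pverts J" "y \<in> pverts J"
  using assms G.edge_subset H.arc_fst H.arc_snd
  by (cases x rule: join_vertex_cases; cases y rule: join_vertex_cases; fastforce)+

lemma arc_J_sym: "(x, y) \<in> parcs J \<Longrightarrow> (y, x) \<in> parcs J"
  using H.arc_sym by (cases x rule: join_vertex_cases; cases y rule: join_vertex_cases; simp)

lemma arc_J_irrefl: "(x, x) \<notin> parcs J"
  using H.arc_irrefl by (cases x rule: join_vertex_cases) simp_all

lemma finite_verts_J: "finite (pverts J)"
  by (simp add: verts_J G.finite_verts H.finite_verts G.finite_edge_set)

lemma wf_J: "wf_digraph (with_proj J)"
  by unfold_locales (use arc_J_verts in \<open>auto simp del: in_arcs_J\<close>)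

lemma pair_graph_J: "pair_graph J"
proof unfold_locales
  have "parcs J \<subseteq> pverts J \<times> pverts J" using arc_J_verts by auto
  then show "finite (parcs J)" by (rule finite_subset) (simp add: finite_verts_J)
  show "symmetric (with_proj J)" using arc_J_sym by (auto simp: symmetric_def intro: symI)
qed (use arc_J_verts arc_J_irrefl finite_verts_J in auto)

lemma join_dist_self: "join_dist H x x = 0"
  by (cases x rule: join_vertex_cases) auto

lemma join_dist_step:
  assumes "(x, y) \<in> parcs J"
  shows "join_dist H x z \<le> Suc (join_dist H y z)"
  using assms
  by (cases x rule: join_vertex_cases; cases y rule: join_vertex_cases; cases z rule: join_vertex_cases;
      auto)

lemma join_dist_down:
  assumes "x \<in> pverts J" "z \<in> pverts J" "x \<noteq> z"
  shows "\<exists>y. (x, y) \<in> parcs J \<and> join_dist H x z = Suc (join_dist H y z)"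
proof -
  obtain v0 w0 where v0: "v0 \<in> pverts G" and w0: "w0 \<in> pverts H"
    using G.verts_nonempty H.verts_nonempty by auto
  have endpoint: "\<exists>u. u \<in> e \<and> u \<in> pverts G" if "e \<in> edge_set G" for e
    using that by (auto elim: G.edge_setE)
  show ?thesis
  proof (cases x rule: join_vertex_cases)
    case x: (vertex u)
    show ?thesis
    proof (cases z rule: join_vertex_cases)
      case (vertex v)
      then show ?thesis using assms x w0 by (intro exI[of _ "Inr w0"]) auto
    next
      case (edge e)
      show ?thesis
      proof (cases "u \<in> e")
        case True
        then show ?thesis using assms x edge by (intro exI[of _ "Inl (Inr e)"]) auto
      next
        case False
        then show ?thesis using assms x edge w0 by (intro exI[of _ "Inr w0"]) auto
      qed
    next
      case (right w)
      then show ?thesis using assms x by (intro exI[of _ "Inr w"]) auto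
    qed
  next
    case x: (edge e)
    show ?thesis
    proof (cases z rule: join_vertex_cases)
      case (vertex v)
      show ?thesis
      proof (cases "v \<in> e")
        case True
        then show ?thesis using assms x vertex by (intro exI[of _ "Inl (Inl v)"]) auto
      next
        case False
        from endpoint[of e] assms x obtain u where "u \<in> e" by auto
        with False show ?thesis using assms x vertex by (intro exI[of _ "Inl (Inl u)"]) auto
      qed
    next
      case (edge f)
      show ?thesis
      proof (cases "e \<inter> f = {}")
        case True
        from endpoint[of e] assms x obtain u where "u \<in> e" by auto
        with True show ?thesis using assms x edge by (intro exI[of _ "Inl (Inl u)"]) auto
      next
        case False
        then obtain u where "u \<in> e" "u \<in> f" by auto
        then show ?thesis using assms x edge by (intro exI[of _ "Inl (Inl u)"]) auto
      qed
    next
      case (right w)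
      from endpoint[of e] assms x obtain u where "u \<in> e" "u \<in> pverts G" by auto
      then show ?thesis using assms x right by (intro exI[of _ "Inl (Inl u)"]) auto
    qed
  next
    case x: (right w)
    show ?thesis
    proof (cases z rule: join_vertex_cases)
      case (vertex v)
      then show ?thesis using assms x by (intro exI[of _ "Inl (Inl v)"]) auto
    next
      case (edge f)
      from endpoint[of f] assms edge obtain u where "u \<in> f" "u \<in> pverts G" by auto
      then show ?thesis using assms x edge by (intro exI[of _ "Inl (Inl u)"]) auto
    next
      case (right w')
      show ?thesis
      proof (cases "(w, w') \<in> parcs H")
        case True
        then show ?thesis using assms x right by (intro exI[of _ "Inr w'"]) auto
      next
        case False
        then show ?thesis using assms x right v0 by (intro exI[of _ "Inl (Inl v0)"]) auto
      qed
    qed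
  qed
qed

lemma graph_dist_J:
  assumes "x \<in> pverts J" "z \<in> pverts J"
  shows "graph_dist J x z = join_dist H x z"
  by (rule graph_dist_eq_potential[OF wf_J assms join_dist_self])
    (simp_all add: join_dist_step join_dist_down assms(2))

lemma connected_graph_J: "connected_graph J"
proof -
  interpret wf_digraph "with_proj J" by (rule wf_J)
  have "strongly_connected (with_proj J)"
  proof
    show "verts (with_proj J) \<noteq> {}" using G.verts_nonempty by (auto simp: verts_J)
    fix x z assume xz: "x \<in> verts (with_proj J)" "z \<in> verts (with_proj J)"
    have "\<exists>p. awalk x p z \<and> length p = join_dist H x z"
    proof (rule awalk_of_potential[OF xz join_dist_self])
      fix x assume "x \<in> verts (with_proj J)" "x \<noteq> z"
      with xz join_dist_down[of x z] obtain y where "(x, y) \<in> parcs J" "join_dist H x z = Suc (join_dist H y z)"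
        by auto
      then show "\<exists>e\<in>arcs (with_proj J). tail (with_proj J) e = x \<and>
          join_dist H x z = Suc (join_dist H (head (with_proj J) e) z)"
        by (intro bexI[of _ "(x, y)"]) auto
    qed
    then show "x \<rightarrow>\<^sup>*\<^bsub>with_proj J\<^esub> z" by (auto simp: reachable_awalk)
  qed
  moreover have "symmetric (with_proj J)" using arc_J_sym by (auto simp: symmetric_def intro: symI)
  ultimately have "Digraph_Component.connected (with_proj J)"
    by (simp add: connected_def strongly_connected_def reachable_mk_symmetric_eq)
  then show ?thesis by (simp add: connected_graph_def pair_graph_J)
qed

lemma join_dist_image:
  assumes "x \<in> pverts J"
  shows "join_dist H x ` pverts J =
    join_dists (card (pverts G)) r (card (pverts H)) s (join_class x)"
proof -
  obtain v0 w0 where v0: "v0 \<in> pverts G" and w0: "w0 \<in> pverts H"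
    using G.verts_nonempty H.verts_nonempty by auto
  note m = G.card_edge_set[symmetric]
  show ?thesis
  proof (cases x rule: join_vertex_cases)
    case (vertex v)
    with assms have v: "v \<in> pverts G" by simp
    have "join_dist H x ` Inl ` Inl ` pverts G = {0} \<union> (if \<exists>u\<in>pverts G. u \<noteq> v then {2} else {})"
    proof -
      have "\<exists>u\<in>pverts G. v = u" using v by blast
      moreover have "(\<exists>u\<in>pverts G. v \<noteq> u) \<longleftrightarrow> (\<exists>u\<in>pverts G. u \<noteq> v)" by metis
      ultimately show ?thesis
        by (simp only: vertex image_image join_dist.simps image_if image_const_Collect if_True)
    qed
    moreover have "join_dist H x ` Inl ` Inr ` edge_set G =
        (if \<exists>e\<in>edge_set G. v \<in> e then {1} else {}) \<union> (if \<exists>e\<in>edge_set G. v \<notin> e then {3} else {})"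
      by (simp only: vertex image_image join_dist.simps image_if image_const_Collect)
    moreover have "join_dist H x ` Inr ` pverts H = {1}"
      using w0 by (auto simp: vertex image_image)
    ultimately show ?thesis
      unfolding verts_J image_Un G.other_vertex_iff[OF v] G.edge_avoiding_vertex_iff[OF v]
      by (auto simp: join_dists_def vertex m Let_def)
  next
    case (edge e)
    with assms have e: "e \<in> edge_set G" by simp
    have "join_dist H x ` Inl ` Inl ` pverts G = {1} \<union> (if \<exists>v\<in>pverts G. v \<notin> e then {3} else {})"
    proof -
      have "\<exists>v\<in>pverts G. v \<in> e" using e by (auto elim: G.edge_setE)
      then show ?thesis
        by (simp only: edge image_image join_dist.simps image_if image_const_Collect if_True)
    qed
    moreover have "join_dist H x ` Inl ` Inr ` edge_set G = {0} \<union>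
        (if \<exists>f\<in>edge_set G. e \<inter> f = {} then {4} else {}) \<union>
        (if \<exists>f\<in>edge_set G. e \<noteq> f \<and> e \<inter> f \<noteq> {} then {2} else {})"
    proof -
      have "e \<noteq> {}" using G.card_edge[OF e] by auto
      then have "(\<exists>f\<in>{f \<in> edge_set G. e \<noteq> f}. e \<inter> f = {}) \<longleftrightarrow> (\<exists>f\<in>edge_set G. e \<inter> f = {})"
        by blast
      moreover have "{f \<in> {f \<in> edge_set G. e \<noteq> f}. e \<inter> f \<noteq> {}} = {f \<in> edge_set G. e \<noteq> f \<and> e \<inter> f \<noteq> {}}"
        by blast
      moreover have "\<exists>f\<in>edge_set G. e = f" using e by blast
      ultimately show ?thesis
        by (simp only: edge image_image join_dist.simps image_if image_const_Collect) auto
    qed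
    moreover have "join_dist H x ` Inr ` pverts H = {2}"
      using w0 by (auto simp: edge image_image)
    ultimately show ?thesis
      unfolding verts_J image_Un G.vertex_outside_edge_iff[OF e] G.disjoint_edge_iff[OF e]
      by (auto simp: join_dists_def edge m Let_def)
  next
    case (right w)
    with assms have w: "w \<in> pverts H" by simp
    have "join_dist H x ` Inl ` Inl ` pverts G = {1}"
      using v0 by (auto simp: right image_image)
    moreover have "join_dist H x ` Inl ` Inr ` edge_set G = (if 0 < card (edge_set G) then {2} else {})"
      using G.finite_edge_set by (auto simp: right image_image card_gt_0_iff)
    moreover have "join_dist H x ` Inr ` pverts H = {0} \<union>
       (if \<exists>u\<in>pverts H. (w, u) \<in> parcs H then {1} else {}) \<union> (if \<exists>u\<in>pverts H. u \<noteq> w \<and> (w, u) \<notin> parcs H then {2} else {})"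
    proof -
      have "(\<exists>u\<in>{u \<in> pverts H. w \<noteq> u}. (w, u) \<in> parcs H) \<longleftrightarrow> (\<exists>u\<in>pverts H. (w, u) \<in> parcs H)"
        using H.arc_irrefl[of w] by blast
      moreover have "{u \<in> {u \<in> pverts H. w \<noteq> u}. (w, u) \<notin> parcs H} = {u \<in> pverts H. u \<noteq> w \<and> (w, u) \<notin> parcs H}"
        by blast
      moreover have "\<exists>u\<in>pverts H. w = u" using w by blast
      ultimately show ?thesis
        by (simp only: right image_image join_dist.simps image_if image_const_Collect) auto
    qed
    ultimately show ?thesis
      unfolding verts_J image_Un H.nonneighbour_iff[OF w]
      by (auto simp: join_dists_def right m Let_def)
  qed
qed

lemma eccentricity_J:
  assumes "x \<in> pverts J"
  shows "eccentricity J x =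
    Max (real ` join_dists (card (pverts G)) r (card (pverts H)) s (join_class x))"
proof -
  have "{graph_dist J x u | u. u \<in> pverts J} = (\<lambda>u. real (join_dist H x u)) ` pverts J"
    unfolding Setcompr_eq_image Collect_mem_eq by (rule image_cong) (simp_all add: graph_dist_J assms)
  then show ?thesis
    unfolding eccentricity_def join_dist_image[OF assms, symmetric] by (simp add: image_image)
qed

end

section \<open>The characteristic polynomial of the eccentricity matrix\<close>

text \<open>
  The block diagonal part \<open>M\<close>. The entry of \<open>B\<^sup>t B\<close> at two edges is the number of their common
  endpoints, which is why \<open>c I + d B\<^sup>t B\<close> takes one value each on equal, adjacent and disjoint edges.
\<close>

fun join_core :: "real \<Rightarrow> real \<Rightarrow> real \<Rightarrow> real \<Rightarrow> ('b \<Rightarrow> 'b \<Rightarrow> real) \<Rightarrow>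
    ('a + 'a set) + 'b \<Rightarrow> ('a + 'a set) + 'b \<Rightarrow> real" where
  "join_core a b c d h (Inl (Inl u)) (Inl (Inl v)) = (if u = v then a else 0)"
| "join_core a b c d h (Inl (Inl u)) (Inl (Inr e)) = b * of_bool (u \<in> e)"
| "join_core a b c d h (Inl (Inr e)) (Inl (Inl u)) = b * of_bool (u \<in> e)"
| "join_core a b c d h (Inl (Inr e)) (Inl (Inr f)) = (if e = f then c else 0) + d * real (card (e \<inter> f))"
| "join_core a b c d h (Inl x) (Inr w) = 0"
| "join_core a b c d h (Inr w) (Inl x) = 0"
| "join_core a b c d h (Inr w) (Inr z) = h w z"

definition join_core_row_sum :: "real \<Rightarrow> real \<Rightarrow> real \<Rightarrow> real \<Rightarrow> real \<Rightarrow> real \<Rightarrow> nat \<Rightarrow> nat \<Rightarrow> real" where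
  "join_core_row_sum a b c d \<rho> \<eta> i j =
     [[a, b * \<rho>, 0], [2 * b, c + 2 * d * \<rho>, 0], [0, 0, \<eta>]] ! i ! j"

definition dist_if_eccentric :: "(nat \<Rightarrow> real) \<Rightarrow> nat \<Rightarrow> nat \<Rightarrow> nat \<Rightarrow> real" where
  "dist_if_eccentric E i j t = (if real t = min (E i) (E j) then real t else 0)"

text \<open>
  The distances listed are those of the generic pairs of vertices in the two classes: distinct vertices,
  non-incident vertex and edge, disjoint edges, and so on. \<open>join_core\<close> corrects the other entries.
\<close>

definition join_generic_entry :: "(nat \<Rightarrow> real) \<Rightarrow> nat \<Rightarrow> nat \<Rightarrow> real" where
  "join_generic_entry E i j = dist_if_eccentric E i j ([[2, 3, 1], [3, 4, 2], [1, 2, 2]] ! i ! j)"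

lemma dist_if_eccentric_sym: "dist_if_eccentric E i j t = dist_if_eccentric E j i t"
  by (simp add: dist_if_eccentric_def min.commute)

lemma card_Int_doubletons:
  assumes "card e = 2" "card f = 2"
  shows "card (e \<inter> f) = (if e = f then 2 else if e \<inter> f = {} then 0 else 1)"
proof (cases "e = f")
  case False
  have fin: "finite e" "finite f" using assms by (auto intro: card_ge_0_finite)
  have "card (e \<inter> f) \<noteq> 2"
  proof
    assume "card (e \<inter> f) = 2"
    then have "e \<inter> f = e" "e \<inter> f = f" 
      using card_subset_eq[OF fin(1), of "e \<inter> f"] card_subset_eq[OF fin(2), of "e \<inter> f"] assms by auto
    with False show False by simp
  qed
  moreover have "card (e \<inter> f) \<le> 2" using card_mono[OF fin(1), of "e \<inter> f"] assms by auto
  moreover have "card (e \<inter> f) = 0 \<longleftrightarrow> e \<inter> f = {}" using fin by simp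
  ultimately show ?thesis using False by (auto simp del: card_0_eq)
qed (use assms in auto)

context regular_join
begin

lemma eccentricity_matrix_entry:
  fixes E defines "E \<equiv> \<lambda>i. Max (real ` join_dists (card (pverts G)) r (card (pverts H)) s i)"
  assumes xy: "x \<in> pverts J" "y \<in> pverts J"
  defines "\<phi> \<equiv> dist_if_eccentric E"
  shows "(if graph_dist J x y = min (eccentricity J x) (eccentricity J y) then graph_dist J x y else 0) =
    join_core (\<phi> 0 0 0 - \<phi> 0 0 2) (\<phi> 0 1 1 - \<phi> 0 1 3)
      (\<phi> 1 1 0 - \<phi> 1 1 4 - 2 * (\<phi> 1 1 2 - \<phi> 1 1 4)) (\<phi> 1 1 2 - \<phi> 1 1 4)
      (\<lambda>w z. (if w = z then \<phi> 2 2 0 - \<phi> 2 2 2 else 0) + (\<phi> 2 2 1 - \<phi> 2 2 2) * of_bool ((w, z) \<in> parcs H)) x y +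
    join_generic_entry E (join_class x) (join_class y)"
proof -
  have "(if graph_dist J x y = min (eccentricity J x) (eccentricity J y) then graph_dist J x y else 0) =
      \<phi> (join_class x) (join_class y) (join_dist H x y)"
    using xy by (simp add: eccentricity_J graph_dist_J \<phi>_def dist_if_eccentric_def E_def)
  also have "\<dots> = join_core (\<phi> 0 0 0 - \<phi> 0 0 2) (\<phi> 0 1 1 - \<phi> 0 1 3)
      (\<phi> 1 1 0 - \<phi> 1 1 4 - 2 * (\<phi> 1 1 2 - \<phi> 1 1 4)) (\<phi> 1 1 2 - \<phi> 1 1 4)
      (\<lambda>w z. (if w = z then \<phi> 2 2 0 - \<phi> 2 2 2 else 0) + (\<phi> 2 2 1 - \<phi> 2 2 2) * of_bool ((w, z) \<in> parcs H)) x y +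
    \<phi> (join_class x) (join_class y) ([[2, 3, 1], [3, 4, 2], [1, 2, 2]] ! join_class x ! join_class y)"
    using xy dist_if_eccentric_sym[of E 1 0] H.arc_irrefl
    by (cases x rule: join_vertex_cases; cases y rule: join_vertex_cases)
      (auto simp: \<phi>_def card_Int_doubletons[OF G.card_edge G.card_edge])
  finally show ?thesis by (simp add: join_generic_entry_def \<phi>_def)
qed

lemma join_core_row_sum:
  assumes x: "x \<in> pverts J" and j: "j \<in> {0, 1, 2}"
    and h: "\<And>w. w \<in> pverts H \<Longrightarrow> (\<Sum>z\<in>pverts H. h w z) = \<eta>"
  shows "(\<Sum>y | y \<in> pverts J \<and> join_class y = j. join_core a b c d h x y) =
    join_core_row_sum a b c d r \<eta> (join_class x) j"
proof -
  have "{y. y \<in> pverts J \<and> join_class y = 0} = Inl ` Inl ` pverts G"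
    "{y. y \<in> pverts J \<and> join_class y = 1} = Inl ` Inr ` edge_set G"
    "{y. y \<in> pverts J \<and> join_class y = 2} = Inr ` pverts H"
    by (auto simp: verts_J)
  then have sets: "(\<Sum>y | y \<in> pverts J \<and> join_class y = 0. f y) = (\<Sum>u\<in>pverts G. f (Inl (Inl u)))"
    "(\<Sum>y | y \<in> pverts J \<and> join_class y = 1. f y) = (\<Sum>e\<in>edge_set G. f (Inl (Inr e)))"
    "(\<Sum>y | y \<in> pverts J \<and> join_class y = 2. f y) = (\<Sum>w\<in>pverts H. f (Inr w))" for f :: "_ \<Rightarrow> real"
    by (simp_all add: sum.reindex)
  show ?thesis
  proof (cases x rule: join_vertex_cases)
    case (vertex u)
    with x have u: "u \<in> pverts G" by simp
    have "(\<Sum>e\<in>edge_set G. b * of_bool (u \<in> e)) = b * r"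
      using G.card_incident_edges[OF u] G.finite_edge_set
      by (simp add: sum_of_bool_eq Int_def flip: sum_distrib_left)
    with u j show ?thesis
      by (auto simp: sets[simplified] vertex join_core_row_sum_def G.finite_verts)
  next
    case (edge e)
    with x have e: "e \<in> edge_set G" by simp
    have "pverts G \<inter> {u. u \<in> e} = e" using G.edge_subset[OF e] by auto
    then have "(\<Sum>u\<in>pverts G. b * of_bool (u \<in> e)) = 2 * b"
      using G.card_edge[OF e] G.finite_verts by (simp add: sum_of_bool_eq flip: sum_distrib_left)
    moreover have "(\<Sum>f\<in>edge_set G. (if e = f then c else 0) + d * real (card (e \<inter> f))) = c + 2 * d * r"
      using arg_cong[OF G.sum_card_Int_edges[OF G.edge_subset[OF e]], of real] G.card_edge[OF e] e G.finite_edge_set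
      by (simp add: sum.distrib flip: sum_distrib_left)
    ultimately show ?thesis using j
      by (auto simp: sets[simplified] edge join_core_row_sum_def)
  next
    case (right w)
    with x j h show ?thesis by (auto simp: sets[simplified] right join_core_row_sum_def)
  qed
qed

end

lemma (in regular_join) poly_char_poly_join_core:
  fixes a b c d t :: real
  assumes vs: "distinct vs" "set vs = pverts G" and es: "distinct es" "set es = edge_set G"
    and ws: "distinct ws" "set ws = pverts H"
    and t: "t \<noteq> a" "t \<noteq> c"
  defines "\<kappa> \<equiv> - d - b\<^sup>2 / (t - a)"
  defines "A \<equiv> kmat vs vs (\<lambda>u v. of_bool ((u, v) \<in> parcs G))"
  defines "xs \<equiv> map Inl (map Inl vs @ map Inr es) @ map Inr ws"
  shows "(t - c) ^ length vs * poly (char_poly (kmat xs xs (join_core a b c d h))) t =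
    (t - a) ^ length vs * (t - c) ^ length es *
    det ((t - c + \<kappa> * r) \<cdot>\<^sub>m 1\<^sub>m (length vs) + \<kappa> \<cdot>\<^sub>m A) * poly (char_poly (kmat ws ws h)) t"
proof -
  let ?B = "kmat vs es (\<lambda>u e. of_bool (u \<in> e) :: real)" and ?C = "kmat es vs (\<lambda>e u. of_bool (u \<in> e) :: real)"
  let ?n = "length vs" and ?m = "length es" and ?k = "length ws"
  let ?f = "\<lambda>x y. (if x = y then t else 0) - join_core a b c d h x y"
  let ?Y = "(t - c) \<cdot>\<^sub>m 1\<^sub>m ?m + (- d) \<cdot>\<^sub>m (?C * ?B)"
  let ?VI = "four_block_mat ((t - a) \<cdot>\<^sub>m 1\<^sub>m ?n) ((- b) \<cdot>\<^sub>m ?B) ((- b) \<cdot>\<^sub>m ?C) ?Y"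
  have "distinct xs" unfolding xs_def using vs es ws by (auto simp: distinct_map inj_on_def)
  have CB: "?C * ?B = kmat es es (\<lambda>e f. real (card (e \<inter> f)))"
    unfolding kmat_mult[OF vs(1)]
  proof (intro kmat_cong, goal_cases)
    case (1 e f)
    have "set vs \<inter> {u. u \<in> e \<and> u \<in> f} = e \<inter> f" using G.edge_subset[of e] 1 vs es by auto
    then show ?case by (simp add: sum_of_bool_eq flip: of_bool_conj)
  qed
  have BC: "?B * ?C = real r \<cdot>\<^sub>m 1\<^sub>m ?n + A"
    unfolding kmat_mult[OF es(1)] A_def kmat_one[OF vs(1), symmetric] kmat_smult kmat_add
    by (intro kmat_cong) (simp add: es vs G.sum_incidence_mult)
  have "kmat xs xs ?f = four_block_mat ?VI (0\<^sub>m (?n + ?m) ?k) (0\<^sub>m ?k (?n + ?m))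
      (kmat ws ws (\<lambda>w z. (if w = z then t else 0) - h w z))"
    unfolding xs_def kmat_append[of "map Inl _"]
  proof (intro cong_four_block_mat)
    show "kmat (map Inl (map Inl vs @ map Inr es)) (map Inl (map Inl vs @ map Inr es)) ?f = ?VI"
      unfolding map_append kmat_append CB kmat_map kmat_one[OF vs(1), symmetric] kmat_one[OF es(1), symmetric]
        kmat_smult kmat_add
      by (intro cong_four_block_mat kmat_cong) auto
    show "kmat (map Inl (map Inl vs @ map Inr es)) (map Inr ws) ?f = 0\<^sub>m (?n + ?m) ?k"
      unfolding kmat_map by (simp add: kmat_zero)
    show "kmat (map Inr ws) (map Inl (map Inl vs @ map Inr es)) ?f = 0\<^sub>m ?k (?n + ?m)"
      unfolding kmat_map by (simp add: kmat_zero)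
    show "kmat (map Inr ws) (map Inr ws) ?f = kmat ws ws (\<lambda>w z. (if w = z then t else 0) - h w z)"
      unfolding kmat_map by (intro kmat_cong) auto
  qed
  moreover have "?VI \<in> carrier_mat (?n + ?m) (?n + ?m)"
    by (intro four_block_carrier_mat) auto
  ultimately have "poly (char_poly (kmat xs xs (join_core a b c d h))) t = det ?VI * poly (char_poly (kmat ws ws h)) t"
    unfolding poly_char_poly_kmat[OF \<open>distinct xs\<close>] poly_char_poly_kmat[OF ws(1)]
    using det_four_block_mat_lower_left_zero[of ?VI "?n + ?m" "0\<^sub>m (?n + ?m) ?k" ?k]
    by (simp add: kmat_def)
  also have "det ?VI = (t - a) ^ ?n * det ((t - c) \<cdot>\<^sub>m 1\<^sub>m ?m + \<kappa> \<cdot>\<^sub>m (?C * ?B))"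
    unfolding \<kappa>_def using det_gram_block[of ?B ?n ?m ?C "t - a" "- b" "t - c" "- d"] t by simp
  finally have "(t - c) ^ ?n * poly (char_poly (kmat xs xs (join_core a b c d h))) t =
      (t - a) ^ ?n * ((t - c) ^ ?n * det ((t - c) \<cdot>\<^sub>m 1\<^sub>m ?m + \<kappa> \<cdot>\<^sub>m (?C * ?B))) * poly (char_poly (kmat ws ws h)) t"
    by simp
  also have "(t - c) ^ ?n * det ((t - c) \<cdot>\<^sub>m 1\<^sub>m ?m + \<kappa> \<cdot>\<^sub>m (?C * ?B)) =
      (t - c) ^ ?m * det ((t - c) \<cdot>\<^sub>m 1\<^sub>m ?n + \<kappa> \<cdot>\<^sub>m (?B * ?C))"
    using t by (intro det_smult_one_add_mult_comm) auto
  also have "(t - c) \<cdot>\<^sub>m 1\<^sub>m ?n + \<kappa> \<cdot>\<^sub>m (?B * ?C) = (t - c + \<kappa> * r) \<cdot>\<^sub>m 1\<^sub>m ?n + \<kappa> \<cdot>\<^sub>m A"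
    unfolding BC by (intro eq_matI) (auto simp: A_def algebra_simps)
  finally show ?thesis by (simp add: mult.assoc)
qed

lemma char_poly_scalar_add_smult_cong:
  fixes A :: "real mat"
  assumes A: "A \<in> carrier_mat n n" and B: "B \<in> carrier_mat n n" and "char_poly A = char_poly B"
  shows "char_poly (p \<cdot>\<^sub>m 1\<^sub>m n + q \<cdot>\<^sub>m A) = char_poly (p \<cdot>\<^sub>m 1\<^sub>m n + q \<cdot>\<^sub>m B)"
proof (rule poly_eqI_cofinite)
  have "poly (char_poly (p \<cdot>\<^sub>m 1\<^sub>m n + q \<cdot>\<^sub>m A)) t = det ((t - p) \<cdot>\<^sub>m 1\<^sub>m n + (- q) \<cdot>\<^sub>m A)"
    if "A \<in> carrier_mat n n" for A t
    unfolding char_poly_def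
    by (rule poly_det_cong[of _ n]) (use that in \<open>auto simp: char_poly_matrix_def\<close>)
  then show "finite {t. poly (char_poly (p \<cdot>\<^sub>m 1\<^sub>m n + q \<cdot>\<^sub>m A)) t \<noteq> poly (char_poly (p \<cdot>\<^sub>m 1\<^sub>m n + q \<cdot>\<^sub>m B)) t}"
    using A B det_smult_one_add_smult_cong[OF assms] by simp
qed

lemma char_poly_eccentricity_matrix_join_cong:
  assumes "regular_join G r H s" and "regular_join G' r H' s"
    and n: "card (pverts G) = card (pverts G')" and k: "card (pverts H) = card (pverts H')"
    and cpG: "char_poly (adjacency_matrix G) = char_poly (adjacency_matrix G')"
    and cpH: "char_poly (adjacency_matrix H) = char_poly (adjacency_matrix H')"
  shows "char_poly (eccentricity_matrix (subdivision_vertex_join G H)) =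
         char_poly (eccentricity_matrix (subdivision_vertex_join G' H'))"
proof -
  interpret P: regular_join G r H s by fact
  interpret P': regular_join G' r H' s by fact
  obtain vs es ws where
    vs: "distinct vs" "set vs = pverts G" and es: "distinct es" "set es = edge_set G"
    and ws: "distinct ws" "set ws = pverts H"
    using finite_distinct_list[OF P.G.finite_verts] finite_distinct_list[OF P.G.finite_edge_set]
      finite_distinct_list[OF P.H.finite_verts] by metis
  obtain vs' es' ws' where
    vs': "distinct vs'" "set vs' = pverts G'" and es': "distinct es'" "set es' = edge_set G'"
    and ws': "distinct ws'" "set ws' = pverts H'"
    using finite_distinct_list[OF P'.G.finite_verts] finite_distinct_list[OF P'.G.finite_edge_set]
      finite_distinct_list[OF P'.H.finite_verts] by metis
  have len: "length vs' = length vs" "length es' = length es" "length ws' = length ws"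
    using vs es ws vs' es' ws' n k P.G.card_edge_set P'.G.card_edge_set by (metis distinct_card)+
  define xs :: "(('a + 'a set) + 'b) list" where "xs = map Inl (map Inl vs @ map Inr es) @ map Inr ws"
  define xs' :: "(('c + 'c set) + 'd) list" where "xs' = map Inl (map Inl vs' @ map Inr es') @ map Inr ws'"
  have xs: "distinct xs" "set xs = pverts P.J"
    unfolding xs_def P.verts_J using vs es ws by (auto simp: distinct_map inj_on_def)
  have xs': "distinct xs'" "set xs' = pverts P'.J"
    unfolding xs'_def P'.verts_J using vs' es' ws' by (auto simp: distinct_map inj_on_def)
  define E where "E = (\<lambda>i. Max (real ` join_dists (card (pverts G)) r (card (pverts H)) s i))"
  define \<phi> where "\<phi> = dist_if_eccentric E"
  define a where "a = \<phi> 0 0 0 - \<phi> 0 0 2"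
  define b where "b = \<phi> 0 1 1 - \<phi> 0 1 3"
  define c where "c = \<phi> 1 1 0 - \<phi> 1 1 4 - 2 * (\<phi> 1 1 2 - \<phi> 1 1 4)"
  define d where "d = \<phi> 1 1 2 - \<phi> 1 1 4"
  define p where "p = \<phi> 2 2 0 - \<phi> 2 2 2"
  define q where "q = \<phi> 2 2 1 - \<phi> 2 2 2"
  define h where "h = (\<lambda>w z. (if w = z then p else 0) + q * of_bool ((w, z) \<in> parcs H))"
  define h' where "h' = (\<lambda>w z. (if w = z then p else 0) + q * of_bool ((w, z) \<in> parcs H'))"
  have row_h: "(\<Sum>z\<in>pverts H. h w z) = p + q * s" if "w \<in> pverts H" for w
  proof -
    have "pverts H \<inter> {z. (w, z) \<in> parcs H} = parcs H `` {w}" using P.H.neighbours_subset[of w] by auto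
    then show ?thesis using that P.H.card_neighbours[OF that] P.H.finite_verts
      by (simp add: h_def sum.distrib sum_of_bool_eq flip: sum_distrib_left)
  qed
  have row_h': "(\<Sum>z\<in>pverts H'. h' w z) = p + q * s" if "w \<in> pverts H'" for w
  proof -
    have "pverts H' \<inter> {z. (w, z) \<in> parcs H'} = parcs H' `` {w}" using P'.H.neighbours_subset[of w] by auto
    then show ?thesis using that P'.H.card_neighbours[OF that] P'.H.finite_verts
      by (simp add: h'_def sum.distrib sum_of_bool_eq flip: sum_distrib_left)
  qed
  let ?A = "kmat vs vs (\<lambda>u v. of_bool ((u, v) \<in> parcs G)) :: real mat"
  let ?A' = "kmat vs' vs' (\<lambda>u v. of_bool ((u, v) \<in> parcs G')) :: real mat"
  let ?D = "kmat ws ws (\<lambda>u v. of_bool ((u, v) \<in> parcs H)) :: real mat"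
  let ?D' = "kmat ws' ws' (\<lambda>u v. of_bool ((u, v) \<in> parcs H')) :: real mat"
  have cpA: "char_poly ?A = char_poly ?A'"
    using cpG char_poly_vertex_matrix[OF vs] char_poly_vertex_matrix[OF vs']
    by (simp add: adjacency_matrix_def of_bool_def)
  have cpD: "char_poly ?D = char_poly ?D'"
    using cpH char_poly_vertex_matrix[OF ws] char_poly_vertex_matrix[OF ws']
    by (simp add: adjacency_matrix_def of_bool_def)
  have "kmat ws ws h = p \<cdot>\<^sub>m 1\<^sub>m (length ws) + q \<cdot>\<^sub>m ?D"
    unfolding kmat_one[OF ws(1), symmetric] kmat_smult kmat_add h_def by (intro kmat_cong) simp
  moreover have "kmat ws' ws' h' = p \<cdot>\<^sub>m 1\<^sub>m (length ws) + q \<cdot>\<^sub>m ?D'"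
    unfolding len(3)[symmetric] kmat_one[OF ws'(1), symmetric] kmat_smult kmat_add h'_def by (intro kmat_cong) simp
  ultimately have cph: "char_poly (kmat ws ws h) = char_poly (kmat ws' ws' h')"
    using char_poly_scalar_add_smult_cong[of ?D "length ws" ?D'] cpD len(3)
    by (metis kmat_carrier)
  have core: "char_poly (kmat xs xs (join_core a b c d h)) = char_poly (kmat xs' xs' (join_core a b c d h'))"
  proof (rule poly_eqI_cofinite, rule finite_subset)
    show "{t. poly (char_poly (kmat xs xs (join_core a b c d h))) t \<noteq>
        poly (char_poly (kmat xs' xs' (join_core a b c d h'))) t} \<subseteq> {a, c}"
    proof (intro subsetI, rule ccontr)
      fix t assume "t \<in> {t. poly (char_poly (kmat xs xs (join_core a b c d h))) t \<noteq>
        poly (char_poly (kmat xs' xs' (join_core a b c d h'))) t}" "t \<notin> {a, c}"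
      then have ne: "poly (char_poly (kmat xs xs (join_core a b c d h))) t \<noteq>
        poly (char_poly (kmat xs' xs' (join_core a b c d h'))) t" and t: "t \<noteq> a" "t \<noteq> c" by auto
      have "det (\<alpha> \<cdot>\<^sub>m 1\<^sub>m (length vs) + \<beta> \<cdot>\<^sub>m ?A) = det (\<alpha> \<cdot>\<^sub>m 1\<^sub>m (length vs) + \<beta> \<cdot>\<^sub>m ?A')" for \<alpha> \<beta>
        using len(1) by (intro det_smult_one_add_smult_cong cpA) (auto simp: kmat_def)
      then have "(t - c) ^ length vs * poly (char_poly (kmat xs xs (join_core a b c d h))) t =
          (t - c) ^ length vs * poly (char_poly (kmat xs' xs' (join_core a b c d h'))) t"
        unfolding xs_def xs'_def
        using P.poly_char_poly_join_core[OF vs es ws t, of b d h]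
          P'.poly_char_poly_join_core[OF vs' es' ws' t, of b d h'] len cph by simp
      with ne t show False by simp
    qed
  qed simp
  have E': "E = (\<lambda>i. Max (real ` join_dists (card (pverts G')) r (card (pverts H')) s i))"
    unfolding E_def n k ..
  have "char_poly (eccentricity_matrix P.J) =
      char_poly (kmat xs xs (\<lambda>x y. join_core a b c d h x y + join_generic_entry E (join_class x) (join_class y)))"
    unfolding eccentricity_matrix_def char_poly_vertex_matrix[OF xs]
    unfolding a_def b_def c_def d_def h_def p_def q_def \<phi>_def E_def
    by (intro arg_cong[of _ _ char_poly] kmat_cong P.eccentricity_matrix_entry) (simp_all only: xs)
  also have "\<dots> = char_poly (kmat xs' xs' (\<lambda>x y. join_core a b c d h' x y +
      join_generic_entry E (join_class x) (join_class y)))"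
  proof (rule char_poly_add_class_function[OF xs(1) xs'(1), where cs = "[0, 1, 2]" and
        q = "join_core_row_sum a b c d r (p + q * s)"])
    show "join_class ` set xs \<subseteq> set [0, 1, 2]" "join_class ` set xs' \<subseteq> set [0, 1, 2]"
      by (auto simp: xs_def xs'_def)
    show "card {x \<in> set xs. join_class x = i} = card {x \<in> set xs'. join_class x = i}" if "i \<in> set [0, 1, 2]" for i
    proof -
      have "{x \<in> set xs. join_class x = i} = (if i = 0 then Inl ` Inl ` set vs else if i = 1 then Inl ` Inr ` set es else Inr ` set ws)"
        "{x \<in> set xs'. join_class x = i} = (if i = 0 then Inl ` Inl ` set vs' else if i = 1 then Inl ` Inr ` set es' else Inr ` set ws')"
        using that by (auto simp: xs_def xs'_def)
      then show ?thesis
        using len vs(1) es(1) ws(1) vs'(1) es'(1) ws'(1)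
        by (simp add: card_image distinct_card)
    qed
    show "(\<Sum>y | y \<in> set xs \<and> join_class y = i. join_core a b c d h x y) =
        join_core_row_sum a b c d r (p + q * s) (join_class x) i" if "x \<in> set xs" "i \<in> set [0, 1, 2]" for x i
      using that P.join_core_row_sum[OF _ _ row_h] unfolding xs by simp
    show "(\<Sum>y | y \<in> set xs' \<and> join_class y = i. join_core a b c d h' x y) =
        join_core_row_sum a b c d r (p + q * s) (join_class x) i" if "x \<in> set xs'" "i \<in> set [0, 1, 2]" for x i
      using that P'.join_core_row_sum[OF _ _ row_h'] unfolding xs' by simp
  qed (simp_all add: core)
  also have "\<dots> = char_poly (eccentricity_matrix P'.J)"
    unfolding eccentricity_matrix_def char_poly_vertex_matrix[OF xs']
    unfolding a_def b_def c_def d_def h'_def p_def q_def \<phi>_def E'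
    by (intro arg_cong[of _ _ char_poly] kmat_cong P'.eccentricity_matrix_entry[symmetric]) (simp_all only: xs')
  finally show ?thesis .
qed

section \<open>Recovering the factors of the join\<close>

lemma card_neighbours_iso:
  assumes f: "bij_betw f (pverts J) (pverts J')"
    and arcs: "\<forall>u\<in>pverts J. \<forall>v\<in>pverts J. (u, v) \<in> parcs J \<longleftrightarrow> (f u, f v) \<in> parcs J'"
    and verts: "parcs J `` {x} \<subseteq> pverts J" "parcs J' `` {f x} \<subseteq> pverts J'" and x: "x \<in> pverts J"
  shows "card (parcs J' `` {f x}) = card (parcs J `` {x})"
proof -
  have "parcs J' `` {f x} = f ` (parcs J `` {x})"
  proof (intro equalityI subsetI)
    fix z assume z: "z \<in> parcs J' `` {f x}"
    then have "z \<in> f ` pverts J" using verts(2) f by (auto simp: bij_betw_def)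
    then obtain y where "y \<in> pverts J" "z = f y" by auto
    with z arcs x show "z \<in> f ` (parcs J `` {x})" by auto
  next
    fix z assume "z \<in> f ` (parcs J `` {x})"
    then obtain y where "(x, y) \<in> parcs J" "z = f y" by auto
    with verts(1) arcs x show "z \<in> parcs J' `` {f x}" by auto
  qed
  moreover have "inj_on f (parcs J `` {x})"
    using f verts(1) by (auto simp: bij_betw_def intro: inj_on_subset)
  ultimately show ?thesis by (simp add: card_image)
qed

lemma digraph_iso_of_restriction:
  assumes wf: "wf_digraph (with_proj G)" "wf_digraph (with_proj G')"
    and f: "bij_betw f B B'" and A: "A \<subseteq> B" "A' \<subseteq> B'" "\<And>x. x \<in> B \<Longrightarrow> x \<in> A \<longleftrightarrow> f x \<in> A'"
    and g: "bij_betw g (pverts G) A" and g': "bij_betw g' (pverts G') A'"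
    and R: "\<And>u v. u \<in> pverts G \<Longrightarrow> v \<in> pverts G \<Longrightarrow> (u, v) \<in> parcs G \<longleftrightarrow> R (g u) (g v)"
    and R': "\<And>u v. u \<in> pverts G' \<Longrightarrow> v \<in> pverts G' \<Longrightarrow> (u, v) \<in> parcs G' \<longleftrightarrow> R' (g' u) (g' v)"
    and RR': "\<And>x y. x \<in> A \<Longrightarrow> y \<in> A \<Longrightarrow> R x y \<longleftrightarrow> R' (f x) (f y)"
  shows "digraph_iso (with_proj G) (with_proj G')"
proof -
  have "f ` A = A'"
  proof (intro equalityI subsetI)
    fix y assume "y \<in> A'"
    with A(2) f obtain x where "x \<in> B" "y = f x" by (auto simp: bij_betw_def)
    with A(3) \<open>y \<in> A'\<close> show "y \<in> f ` A" by auto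
  next
    fix y assume "y \<in> f ` A"
    with A show "y \<in> A'" by auto
  qed
  then have fA: "bij_betw f A A'"
    using f A(1) by (auto simp: bij_betw_def intro: inj_on_subset)
  let ?h = "inv_into (pverts G') g' \<circ> (f \<circ> g)"
  have h: "bij_betw ?h (pverts G) (pverts G')"
    by (rule bij_betw_trans[OF bij_betw_trans[OF g fA] bij_betw_inv_into[OF g']])
  have gh: "g' (?h u) = f (g u)" if "u \<in> pverts G" for u
  proof -
    have "f (g u) \<in> A'" using that g fA by (auto simp: bij_betw_def)
    then show ?thesis using bij_betw_inv_into_right[OF g'] by simp
  qed
  have "(u, v) \<in> parcs G \<longleftrightarrow> (?h u, ?h v) \<in> parcs G'" if uv: "u \<in> pverts G" "v \<in> pverts G" for u v
  proof -
    have "(u, v) \<in> parcs G \<longleftrightarrow> R' (f (g u)) (f (g v))"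
      using R[OF uv] RR'[of "g u" "g v"] bij_betwE[OF g] uv by blast
    also have "\<dots> \<longleftrightarrow> (?h u, ?h v) \<in> parcs G'"
      using R'[of "?h u" "?h v"] bij_betwE[OF h] uv gh by simp
    finally show ?thesis .
  qed
  with h show ?thesis unfolding digraph_iso_iff[OF wf] by blast
qed

definition adjacent_to_degree_2 :: "'a pair_pre_digraph \<Rightarrow> 'a \<Rightarrow> bool" where
  "adjacent_to_degree_2 J x \<longleftrightarrow> (\<exists>y\<in>pverts J. card (parcs J `` {y}) = 2 \<and> (y, x) \<in> parcs J)"

definition share_degree_2_neighbour :: "'a pair_pre_digraph \<Rightarrow> 'a \<Rightarrow> 'a \<Rightarrow> bool" where
  "share_degree_2_neighbour J x x' \<longleftrightarrow>
     x \<noteq> x' \<and> (\<exists>y\<in>pverts J. card (parcs J `` {y}) = 2 \<and> (y, x) \<in> parcs J \<and> (y, x') \<in> parcs J)"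

context
  fixes J :: "'a pair_pre_digraph" and J' :: "'b pair_pre_digraph" and f
  assumes f: "bij_betw f (pverts J) (pverts J')"
    and arcs: "\<forall>u\<in>pverts J. \<forall>v\<in>pverts J. (u, v) \<in> parcs J \<longleftrightarrow> (f u, f v) \<in> parcs J'"
    and card: "\<forall>x\<in>pverts J. card (parcs J' `` {f x}) = card (parcs J `` {x})"
begin

lemma adjacent_to_degree_2_iso:
  assumes "x \<in> pverts J"
  shows "adjacent_to_degree_2 J' (f x) \<longleftrightarrow> adjacent_to_degree_2 J x"
proof -
  have "pverts J' = f ` pverts J" using f by (auto simp: bij_betw_def)
  then show ?thesis using assms arcs card by (simp add: adjacent_to_degree_2_def cong: conj_cong)
qed

lemma share_degree_2_neighbour_iso:
  assumes "x \<in> pverts J" "x' \<in> pverts J"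
  shows "share_degree_2_neighbour J' (f x) (f x') \<longleftrightarrow> share_degree_2_neighbour J x x'"
proof -
  have "pverts J' = f ` pverts J" "inj_on f (pverts J)" using f by (auto simp: bij_betw_def)
  then show ?thesis using assms arcs card
    by (simp add: share_degree_2_neighbour_def inj_on_eq_iff cong: conj_cong)
qed

end

context regular_join
begin

lemma card_verts_J: "card (pverts J) = card (pverts G) + card (pverts G) * r div 2 + card (pverts H)"
proof -
  have "card (Inl ` (Inl ` pverts G \<union> Inr ` edge_set G) :: (('a + 'a set) + 'b) set) =
      card (pverts G) + card (edge_set G)"
    using G.finite_verts G.finite_edge_set
    by (subst card_image, simp, subst card_Un_disjoint) (auto simp: card_image)
  then have "card (Inl ` (Inl ` pverts G \<union> Inr ` edge_set G) \<union> Inr ` pverts H :: (('a + 'a set) + 'b) set) =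
      card (pverts G) + card (edge_set G) + card (pverts H)"
    using G.finite_verts G.finite_edge_set H.finite_verts
    by (subst card_Un_disjoint) (auto simp: card_image)
  then show ?thesis by (simp add: verts_J G.card_edge_set image_Un)
qed

lemma card_neighbours_J:
  assumes "x \<in> pverts J"
  shows "card (parcs J `` {x}) =
    [r + card (pverts H), 2, card (pverts G) + s] ! join_class x"
proof (cases x rule: join_vertex_cases)
  case (vertex u)
  with assms have u: "u \<in> pverts G" by simp
  have "y \<in> parcs J `` {x} \<longleftrightarrow> y \<in> Inl ` Inr ` {e \<in> edge_set G. u \<in> e} \<union> Inr ` pverts H" for y
    using u by (cases y rule: join_vertex_cases) (auto simp: vertex)
  then have eq: "parcs J `` {x} = Inl ` Inr ` {e \<in> edge_set G. u \<in> e} \<union> Inr ` pverts H" by blast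
  have "card (Inl ` Inr ` {e \<in> edge_set G. u \<in> e} \<union> Inr ` pverts H :: (('a + 'a set) + 'b) set) =
      card {e \<in> edge_set G. u \<in> e} + card (pverts H)"
    using G.finite_edge_set H.finite_verts
    by (subst card_Un_disjoint) (auto simp: card_image inj_on_def)
  then show ?thesis unfolding eq G.card_incident_edges[OF u] by (simp add: vertex)
next
  case (edge e)
  with assms have e: "e \<in> edge_set G" by simp
  have "y \<in> parcs J `` {x} \<longleftrightarrow> y \<in> Inl ` Inl ` e" for y
    using e by (cases y rule: join_vertex_cases) (auto simp: edge)
  then have "parcs J `` {x} = Inl ` Inl ` e" by blast
  then show ?thesis using G.card_edge[OF e] by (simp add: edge card_image inj_on_def)
next
  case (right w)
  with assms have w: "w \<in> pverts H" by simp
  have "y \<in> parcs J `` {x} \<longleftrightarrow> y \<in> Inl ` Inl ` pverts G \<union> Inr ` (parcs H `` {w})" for y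
    using w by (cases y rule: join_vertex_cases) (auto simp: right)
  then have eq: "parcs J `` {x} = Inl ` Inl ` pverts G \<union> Inr ` (parcs H `` {w})" by blast
  have "card (Inl ` Inl ` pverts G \<union> Inr ` (parcs H `` {w}) :: (('a + 'a set) + 'b) set) =
      card (pverts G) + card (parcs H `` {w})"
    using G.finite_verts H.finite_neighbours
    by (subst card_Un_disjoint) (auto simp: card_image inj_on_def)
  then show ?thesis unfolding eq H.card_neighbours[OF w] by (simp add: right)
qed

lemma neighbours_J_subset: "parcs J `` {x} \<subseteq> pverts J"
  using arc_J_verts(2) by blast

lemma degree_2_iff_edge:
  assumes "2 < r + card (pverts H)" "2 < card (pverts G) + s" and "x \<in> pverts J"
  shows "card (parcs J `` {x}) = 2 \<longleftrightarrow> join_class x = 1"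
  using assms card_neighbours_J[OF assms(3)] by (cases x rule: join_vertex_cases) auto

lemma adjacent_to_degree_2_iff:
  assumes "2 < r + card (pverts H)" "2 < card (pverts G) + s" and x: "x \<in> pverts J"
  shows "adjacent_to_degree_2 J x \<longleftrightarrow> join_class x = 0 \<and> 0 < r"
proof (cases x rule: join_vertex_cases)
  case (vertex u)
  with x have u: "u \<in> pverts G" by simp
  have "adjacent_to_degree_2 J x \<longleftrightarrow> (\<exists>e\<in>edge_set G. u \<in> e)"
    unfolding adjacent_to_degree_2_def
  proof
    assume "\<exists>y\<in>pverts J. card (parcs J `` {y}) = 2 \<and> (y, x) \<in> parcs J"
    then obtain y where y: "y \<in> pverts J" "join_class y = 1" "(y, x) \<in> parcs J"
      using degree_2_iff_edge[OF assms(1,2)] by blast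
    then show "\<exists>e\<in>edge_set G. u \<in> e" by (cases y rule: join_vertex_cases) (auto simp: vertex)
  next
    assume "\<exists>e\<in>edge_set G. u \<in> e"
    then obtain e where "e \<in> edge_set G" "u \<in> e" by blast
    then show "\<exists>y\<in>pverts J. card (parcs J `` {y}) = 2 \<and> (y, x) \<in> parcs J"
      using degree_2_iff_edge[OF assms(1,2), of "Inl (Inr e)"]
      by (intro bexI[of _ "Inl (Inr e)"]) (auto simp: vertex)
  qed
  also have "\<dots> \<longleftrightarrow> {e \<in> edge_set G. u \<in> e} \<noteq> {}" by blast
  also have "\<dots> \<longleftrightarrow> 0 < r"
    using G.card_incident_edges[OF u] G.finite_edge_set by (simp add: card_gt_0_iff flip: G.card_incident_edges[OF u])
  finally show ?thesis by (simp add: vertex)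
next
  case (edge e)
  have "join_class y = 1 \<longrightarrow> (y, x) \<notin> parcs J" for y
    by (cases y rule: join_vertex_cases) (auto simp: edge)
  then show ?thesis
    using degree_2_iff_edge[OF assms(1,2)] by (auto simp: adjacent_to_degree_2_def edge)
next
  case (right w)
  have "join_class y = 1 \<longrightarrow> (y, x) \<notin> parcs J" for y
    by (cases y rule: join_vertex_cases) (auto simp: right)
  then show ?thesis
    using degree_2_iff_edge[OF assms(1,2)] by (auto simp: adjacent_to_degree_2_def right)
qed

lemma share_degree_2_neighbour_iff:
  assumes "2 < r + card (pverts H)" "2 < card (pverts G) + s"
    and uv: "u \<in> pverts G" "v \<in> pverts G"
  shows "share_degree_2_neighbour J (Inl (Inl u)) (Inl (Inl v)) \<longleftrightarrow> (u, v) \<in> parcs G"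
proof
  assume "share_degree_2_neighbour J (Inl (Inl u)) (Inl (Inl v))"
  then obtain y where "y \<in> pverts J" "join_class y = 1" and y: "(y, Inl (Inl u)) \<in> parcs J"
    "(y, Inl (Inl v)) \<in> parcs J" and "u \<noteq> v"
    using degree_2_iff_edge[OF assms(1,2)] by (auto simp: share_degree_2_neighbour_def)
  then obtain e where e: "y = Inl (Inr e)" "e \<in> edge_set G" by (cases y rule: join_vertex_cases) auto
  with y have "u \<in> e" "v \<in> e" by auto
  with e \<open>u \<noteq> v\<close> show "(u, v) \<in> parcs G"
    using G.edge_eqI[of e u v] by (simp flip: G.doubleton_edge_iff)
next
  assume uv: "(u, v) \<in> parcs G"
  then have "{u, v} \<in> edge_set G" by (simp add: G.doubleton_edge_iff)
  then show "share_degree_2_neighbour J (Inl (Inl u)) (Inl (Inl v))"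
    unfolding share_degree_2_neighbour_def
    using degree_2_iff_edge[OF assms(1,2), of "Inl (Inr {u, v})"] uv G.arc_irrefl[of u]
    by (auto intro!: bexI[of _ "Inl (Inr {u, v})"])
qed

end

lemma digraph_iso_left_of_join:
  assumes "regular_join G r H s" and "regular_join G' r H' s"
    and "card (pverts G') = card (pverts G)" "card (pverts H') = card (pverts H)"
    and deg: "2 < r + card (pverts H)" "2 < card (pverts G) + s" "0 < r"
    and iso: "digraph_iso (with_proj (subdivision_vertex_join G H)) (with_proj (subdivision_vertex_join G' H'))"
  shows "digraph_iso (with_proj G) (with_proj G')"
proof -
  interpret P: regular_join G r H s by fact
  interpret P': regular_join G' r H' s by fact
  obtain f where f: "bij_betw f (pverts P.J) (pverts P'.J)"
    and arcs: "\<forall>u\<in>pverts P.J. \<forall>v\<in>pverts P.J. (u, v) \<in> parcs P.J \<longleftrightarrow> (f u, f v) \<in> parcs P'.J"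
    using iso unfolding digraph_iso_iff[OF P.wf_J P'.wf_J] by blast
  have card: "\<forall>x\<in>pverts P.J. card (parcs P'.J `` {f x}) = card (parcs P.J `` {x})"
    using card_neighbours_iso[OF f arcs P.neighbours_J_subset P'.neighbours_J_subset] by blast
  have deg': "2 < r + card (pverts H')" "2 < card (pverts G') + s" using deg assms(3,4) by auto
  let ?A = "{x \<in> pverts P.J. join_class x = 0}" and ?A' = "{x \<in> pverts P'.J. join_class x = 0}"
  have A: "?A = (Inl \<circ> Inl) ` pverts G" "?A' = (Inl \<circ> Inl) ` pverts G'"
    by (auto simp: P.verts_J P'.verts_J)
  show ?thesis
  proof (rule digraph_iso_of_restriction[OF P.G.wf P'.G.wf f, of ?A ?A' "Inl \<circ> Inl" "Inl \<circ> Inl"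
        "share_degree_2_neighbour P.J" "share_degree_2_neighbour P'.J"])
    fix x assume x: "x \<in> pverts P.J"
    then have fx: "f x \<in> pverts P'.J" using f by (auto simp: bij_betw_def)
    show "x \<in> ?A \<longleftrightarrow> f x \<in> ?A'"
      using adjacent_to_degree_2_iso[OF f arcs card x] P.adjacent_to_degree_2_iff[OF deg(1,2) x]
        P'.adjacent_to_degree_2_iff[OF deg' fx] deg(3) x fx by simp
  next
    fix x y assume "x \<in> ?A" "y \<in> ?A"
    then show "share_degree_2_neighbour P.J x y \<longleftrightarrow> share_degree_2_neighbour P'.J (f x) (f y)"
      using share_degree_2_neighbour_iso[OF f arcs card] by simp
  qed (auto simp: A bij_betw_def inj_on_def P.share_degree_2_neighbour_iff[OF deg(1,2)]
        P'.share_degree_2_neighbour_iff[OF deg'])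
qed

lemma digraph_iso_right_of_join:
  assumes "regular_join G r H s" and "regular_join G' r H' s"
    and eq: "card (pverts G') = card (pverts G)" "card (pverts H') = card (pverts H)"
    and deg: "2 < r + card (pverts H)" "2 < card (pverts G) + s"
    and apex: "r = 0 \<Longrightarrow> card (pverts G) = 1" "Suc s < card (pverts H)"
    and iso: "digraph_iso (with_proj (subdivision_vertex_join G H)) (with_proj (subdivision_vertex_join G' H'))"
  shows "digraph_iso (with_proj H) (with_proj H')"
proof -
  interpret P: regular_join G r H s by fact
  interpret P': regular_join G' r H' s by fact
  obtain f where f: "bij_betw f (pverts P.J) (pverts P'.J)"
    and arcs: "\<forall>u\<in>pverts P.J. \<forall>v\<in>pverts P.J. (u, v) \<in> parcs P.J \<longleftrightarrow> (f u, f v) \<in> parcs P'.J"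
    using iso unfolding digraph_iso_iff[OF P.wf_J P'.wf_J] by blast
  have card: "\<forall>x\<in>pverts P.J. card (parcs P'.J `` {f x}) = card (parcs P.J `` {x})"
    using card_neighbours_iso[OF f arcs P.neighbours_J_subset P'.neighbours_J_subset] by blast
  have deg': "2 < r + card (pverts H')" "2 < card (pverts G') + s" using deg eq by auto
  let ?A = "{x \<in> pverts P.J. join_class x = 2}" and ?A' = "{x \<in> pverts P'.J. join_class x = 2}"
  have A: "?A = Inr ` pverts H" "?A' = Inr ` pverts H'"
    by (auto simp: P.verts_J P'.verts_J)
  have classes: "join_class x = 0 \<or> join_class x = 1 \<or> join_class x = 2" for x :: "('x + 'y) + 'z"
    by (cases x rule: join_vertex_cases) auto
  show ?thesis
  proof (rule digraph_iso_of_restriction[OF P.H.wf P'.H.wf f, of ?A ?A' Inr Inr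
        "\<lambda>x y. (x, y) \<in> parcs P.J" "\<lambda>x y. (x, y) \<in> parcs P'.J"])
    fix x assume x: "x \<in> pverts P.J"
    then have fx: "f x \<in> pverts P'.J" using f by (auto simp: bij_betw_def)
    show "x \<in> ?A \<longleftrightarrow> f x \<in> ?A'"
    proof (cases "r = 0")
      case False
      then show ?thesis
        using adjacent_to_degree_2_iso[OF f arcs card x] bspec[OF card x]
          P.adjacent_to_degree_2_iff[OF deg x] P'.adjacent_to_degree_2_iff[OF deg' fx]
          P.degree_2_iff_edge[OF deg x] P'.degree_2_iff_edge[OF deg' fx]
          classes[of x] classes[of "f x"] x fx by auto
    next
      case True
      then have "card (pverts G) = 1" by (rule apex)
      then show ?thesis
        using True bspec[OF card x] P.card_neighbours_J[OF x] P'.card_neighbours_J[OF fx] apex(2) eq deg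
          classes[of x] classes[of "f x"] x fx by auto
    qed
  next
    fix x y assume "x \<in> ?A" "y \<in> ?A"
    then show "(x, y) \<in> parcs P.J \<longleftrightarrow> (f x, f y) \<in> parcs P'.J"
      using arcs by simp
  qed (auto simp: A bij_betw_def inj_on_def)
qed

lemma eigenvalue_mset_vertex_matrix_eq_iff:
  "eigenvalue_mset (vertex_matrix G f) = eigenvalue_mset (vertex_matrix H g) \<longleftrightarrow>
    char_poly (vertex_matrix G f) = char_poly (vertex_matrix H g)"
  by (rule eigenvalue_mset_eq_iff) (rule vertex_matrix_carrier)+

lemma degree_le_if_char_poly_eq:
  assumes "regular_simple_graph G r" "regular_simple_graph H s"
    and eq: "char_poly (adjacency_matrix G) = char_poly (adjacency_matrix H)"
  shows "r \<le> s"
proof -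
  interpret G: regular_simple_graph G r by fact
  interpret H: regular_simple_graph H s by fact
  let ?vs = "vertex_list G" and ?ws = "vertex_list H"
  let ?a = "\<lambda>u v. if (u, v) \<in> parcs G then 1 else 0 :: real"
  let ?b = "\<lambda>u v. if (u, v) \<in> parcs H then 1 else 0 :: real"
  note vs = vertex_list[OF G.finite_verts] and ws = vertex_list[OF H.finite_verts]
  have "(\<Sum>v\<in>set ?vs. ?a u v) = r" if "u \<in> set ?vs" for u
  proof -
    have "pverts G \<inter> {v. (u, v) \<in> parcs G} = parcs G `` {u}" using G.neighbours_subset[of u] by auto
    with that G.card_neighbours[of u] show ?thesis by (simp add: vs sum.If_cases G.finite_verts)
  qed
  then have "eigenvalue (kmat ?vs ?vs ?a) r"
    using vs G.verts_nonempty by (intro eigenvalue_kmat_row_sum) auto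
  then have "eigenvalue (kmat ?ws ?ws ?b) r"
    using eq
    by (simp add: adjacency_matrix_def vertex_matrix_eq_kmat G.finite_verts H.finite_verts
        eigenvalue_root_char_poly[OF kmat_carrier[of ?vs ?vs]] eigenvalue_root_char_poly[OF kmat_carrier[of ?ws ?ws]]
        vertex_list(1) kmat_dim)
  moreover have "(\<Sum>v\<in>set ?ws. ?b u v) = s" if "u \<in> set ?ws" for u
  proof -
    have "pverts H \<inter> {v. (u, v) \<in> parcs H} = parcs H `` {u}" using H.neighbours_subset[of u] by auto
    with that H.card_neighbours[of u] show ?thesis by (simp add: ws sum.If_cases H.finite_verts)
  qed
  ultimately have "\<bar>real r\<bar> \<le> s"
    by (intro eigenvalue_kmat_abs_le[OF ws(1)]) auto
  then show ?thesis by simp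
qed

lemma digraph_iso_if_complete:
  assumes "regular_simple_graph G r" "regular_simple_graph H r"
    and "Suc r = card (pverts G)" "Suc r = card (pverts H)"
  shows "digraph_iso (with_proj G) (with_proj H)"
proof -
  interpret G: regular_simple_graph G r by fact
  interpret H: regular_simple_graph H r by fact
  obtain f where f: "bij_betw f (pverts G) (pverts H)"
    using finite_same_card_bij[OF G.finite_verts H.finite_verts] assms(3,4) by auto
  have "(u, v) \<in> parcs G \<longleftrightarrow> (f u, f v) \<in> parcs H" if uv: "u \<in> pverts G" "v \<in> pverts G" for u v
  proof -
    have "f u \<in> pverts H" "f v \<in> pverts H" using f uv by (auto simp: bij_betw_def)
    moreover have "f u = f v \<longleftrightarrow> u = v" using f uv by (auto simp: bij_betw_def dest: inj_onD)
    ultimately show ?thesis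
      using G.arc_iff_if_complete[OF assms(3) uv] H.arc_iff_if_complete[OF assms(4)] by simp
  qed
  with f show ?thesis unfolding digraph_iso_iff[OF G.wf H.wf] by blast
qed

theorem corollary3p3:
  fixes G1 :: "'a pair_pre_digraph"
    and G2 :: "'b pair_pre_digraph"
    and H :: "'c pair_pre_digraph"
  assumes "connected_graph G1" and "regular_graph G1"
    and "connected_graph G2" and "regular_graph G2"
    and "cospectral G1 G2"
    and "connected_graph H" and "regular_graph H"
  shows "eps_cospectral (subdivision_vertex_join G1 H) (subdivision_vertex_join G2 H) \<and>
         eps_cospectral (subdivision_vertex_join H G1) (subdivision_vertex_join H G2)"
proof -
  obtain r where G1: "regular_simple_graph G1 r"
    using regular_simple_graph_if_connected[OF assms(1,2)] .
  obtain r' where G2': "regular_simple_graph G2 r'"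
    using regular_simple_graph_if_connected[OF assms(3,4)] .
  obtain s where H: "regular_simple_graph H s"
    using regular_simple_graph_if_connected[OF assms(6,7)] .
  have not_iso: "\<not> digraph_iso (with_proj G1) (with_proj G2)"
    and n: "card (pverts G1) = card (pverts G2)"
    and cp: "char_poly (adjacency_matrix G1) = char_poly (adjacency_matrix G2)"
    using assms(5) by (auto simp: cospectral_def adjacency_matrix_def eigenvalue_mset_vertex_matrix_eq_iff)
  have "r = r'"
    using degree_le_if_char_poly_eq[OF G1 G2' cp] degree_le_if_char_poly_eq[OF G2' G1 cp[symmetric]] by simp
  with G2' have G2: "regular_simple_graph G2 r" by simp
  have G1H: "regular_join G1 r H s" and G2H: "regular_join G2 r H s"
    and HG1: "regular_join H s G1 r" and HG2: "regular_join H s G2 r"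
    using G1 G2 H by (simp_all add: regular_join_def)
  have r1: "Suc r < card (pverts G1)"
    using digraph_iso_if_complete[OF G1 G2] not_iso n regular_simple_graph.degree_less_card[OF G1] by linarith
  then have r2: "2 \<le> r"
    using regular_simple_graph.card_verts_if_degree_le_1[OF G1 assms(1)] by linarith
  have k: "0 < card (pverts H)"
    using regular_simple_graph.degree_less_card[OF H] by simp
  have "card (pverts H) = 1" if "s = 0"
    using regular_simple_graph.card_verts_if_degree_le_1[OF H assms(6)] that by simp
  then have "\<not> digraph_iso (with_proj (subdivision_vertex_join H G1)) (with_proj (subdivision_vertex_join H G2))"
    using digraph_iso_right_of_join[OF HG1 HG2] n r1 r2 k not_iso by auto
  moreover have "\<not> digraph_iso (with_proj (subdivision_vertex_join G1 H)) (with_proj (subdivision_vertex_join G2 H))"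
    using digraph_iso_left_of_join[OF G1H G2H] n r1 r2 k not_iso by auto
  moreover have "card (pverts (subdivision_vertex_join G1 H)) = card (pverts (subdivision_vertex_join G2 H))"
    "card (pverts (subdivision_vertex_join H G1)) = card (pverts (subdivision_vertex_join H G2))"
    using regular_join.card_verts_J[OF G1H] regular_join.card_verts_J[OF G2H]
      regular_join.card_verts_J[OF HG1] regular_join.card_verts_J[OF HG2] n by simp_all
  moreover have
    "char_poly (eccentricity_matrix (subdivision_vertex_join G1 H)) =
     char_poly (eccentricity_matrix (subdivision_vertex_join G2 H))"
    "char_poly (eccentricity_matrix (subdivision_vertex_join H G1)) =
     char_poly (eccentricity_matrix (subdivision_vertex_join H G2))"
    using char_poly_eccentricity_matrix_join_cong[OF G1H G2H] char_poly_eccentricity_matrix_join_cong[OF HG1 HG2]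
      n cp by simp_all
  ultimately show ?thesis
    using regular_join.connected_graph_J[OF G1H] regular_join.connected_graph_J[OF G2H]
      regular_join.connected_graph_J[OF HG1] regular_join.connected_graph_J[OF HG2]
    by (simp add: eps_cospectral_def eccentricity_matrix_def eigenvalue_mset_vertex_matrix_eq_iff)
qed

end
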